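(* Let $\mathcal{G}$ be an additive arithmetical semigroup satisfying Axiom $A^{\#}$ (constants $c_{\mathcal{G}}>0$, $q>1$, $0\le\eta<1$) with $Z_{\mathcal{G}}(-q^{-1})\ne0$ and norm $\|g\|=q^{\partial(g)}$, and let $S\subseteq\mathcal{P}$ have natural density $\delta(S)$. Let $f\colon\mathbb{Z}_{\ge0}\to\mathbb{C}$ be bounded with $f(0)=0$, and let $a\colon\mathcal{G}\to\mathbb{C}$ be supported on $\mathfrak{D}(\mathcal{G},S)$ with $a(e_{\mathcal{G}})=1$ and $\lim_{n\to\infty}\sum_{1\le\partial(g)\le n,\ g\in\mathfrak{D}(\mathcal{G},S)}\frac{|a(g)|}{\|g\|}\log\log\|g\|<\infty$. Then the following three statements are equivalent: (i) $\sum_{\partial(g)=n}Q_S(g)f(d^+(g))=c_{\mathcal{G}}\delta(S)q^n+o(q^n)$ as $n\to\infty$; (ii) $-\lim_{n\to\infty}\sum_{1\le\partial(g)\le n,\ g\in\mathfrak{D}(\mathcal{G},S)}\frac{\mu(g)f(d_-(g))}{\|g\|}=\delta(S)$; (iii) $-\lim_{n\to\infty}\sum_{1\le\partial(g)\le n,\ g\in\mathfrak{D}(\mathcal{G},S)}\frac{(\mu*a)(g)f(d_-(g))}{\|g\|}=\delta(S)$.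
   Context: An additive arithmetical semigroup is a commutative monoid $\mathcal{G}$ (written additively, identity $e_{\mathcal{G}}$) freely generated by a countable set $\mathcal{P}$ of primes, with an additive degree map $\partial\colon\mathcal{G}\to\mathbb{Z}_{\ge0}$, $\partial(e_{\mathcal{G}})=0$, $\partial(P)>0$ for primes, finitely many elements of each degree. Axiom $A^{\#}$: $\#\{g:\partial(g)=n\}=c_{\mathcal{G}}q^n+O(q^{\eta n})$. $Z_{\mathcal{G}}(z)=\prod_{P\in\mathcal{P}}(1-z^{\partial(P)})^{-1}$ (meromorphically continued). Natural density: $\delta(S)=\lim_{n\to\infty}\#\{P\in S:\partial(P)=n\}/\#\{P\in\mathcal{P}:\partial(P)=n\}$. $h\mid g$ iff $g=h+r$, and $g-h:=r$. For $g\ne e_{\mathcal{G}}$, $d_-(g)$ and $d^+(g)$ are the minimal and maximal degrees of primes dividing $g$; $d^+(e_{\mathcal{G}})=0$. $g$ distinguishable: $g\ne e_{\mathcal{G}}$ and a unique prime $P_{\min}(g)\mid g$ has degree $d_-(g)$. $\mathfrak{D}(\mathcal{G},S)=\{g\text{ distinguishable}:P_{\min}(g)\in S\}\cup\{e_{\mathcal{G}}\}$. $Q_S(g)=\#\{P\in S:P\mid g,\ \partial(P)=d^+(g)\}$. $\mu$ is the Möbius function of $\mathcal{G}$; $(\mu*a)(g)=\sum_{h\mid g}\mu(h)a(g-h)$; $a$ supported on $\mathfrak{D}(\mathcal{G},S)$ means $a$ vanishes outside it. *)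

theory Defs
  imports "HOL-Analysis.Analysis" "HOL-Library.Multiset" "HOL-Library.Landau_Symbols"
begin

text \<open>An additive arithmetical semigroup is modelled concretely as the free commutative
monoid on the set of primes, i.e. finite multisets over a type 'p of primes, with
a degree function dg on primes extended additively. The identity is the empty multiset.\<close>

definition degG :: "('p \<Rightarrow> nat) \<Rightarrow> 'p multiset \<Rightarrow> nat" where
  "degG dg g = sum_mset (image_mset dg g)"

definition arith_semigroup :: "('p \<Rightarrow> nat) \<Rightarrow> bool" where
  "arith_semigroup dg \<longleftrightarrow> (\<forall>P. dg P > 0) \<and> (\<forall>n. finite {P. dg P = n})"

definition axiom_A_sharp :: "('p \<Rightarrow> nat) \<Rightarrow> real \<Rightarrow> real \<Rightarrow> real \<Rightarrow> bool" where
  "axiom_A_sharp dg c q \<eta> \<longleftrightarrow> c > 0 \<and> q > 1 \<and> 0 \<le> \<eta> \<and> \<eta> < 1 \<and>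
     (\<lambda>n. real (card {g::'p multiset. degG dg g = n}) - c * q ^ n) \<in> O(\<lambda>n. q powr (\<eta> * real n))"

text \<open>Euler product Z(z) = prod over primes of (1 - z^deg P)^(-1), grouped by degree.\<close>
definition zetaG :: "('p \<Rightarrow> nat) \<Rightarrow> complex \<Rightarrow> complex" where
  "zetaG dg z = (\<Prod>m. inverse ((1 - z ^ Suc m) ^ card {P. dg P = Suc m}))"

text \<open>Z(-1/q) \<noteq> 0 for the meromorphic continuation of Z (holomorphic on the disc of
radius q^(-eta) except for the simple pole at 1/q).\<close>
definition zeta_nonzero_at_minus :: "('p \<Rightarrow> nat) \<Rightarrow> real \<Rightarrow> real \<Rightarrow> bool" where
  "zeta_nonzero_at_minus dg q \<eta> \<longleftrightarrow>
     (\<exists>F. F holomorphic_on (ball (0::complex) (q powr (-\<eta>)) - {complex_of_real (1/q)}) \<and>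
          (\<forall>z\<in>ball 0 (1/q). F z = zetaG dg z) \<and>
          F (complex_of_real (-(1/q))) \<noteq> 0)"

definition d_minus :: "('p \<Rightarrow> nat) \<Rightarrow> 'p multiset \<Rightarrow> nat" where
  "d_minus dg g = Min (dg ` set_mset g)"

definition d_plus :: "('p \<Rightarrow> nat) \<Rightarrow> 'p multiset \<Rightarrow> nat" where
  "d_plus dg g = (if g = {#} then 0 else Max (dg ` set_mset g))"

definition distinguishable :: "('p \<Rightarrow> nat) \<Rightarrow> 'p multiset \<Rightarrow> bool" where
  "distinguishable dg g \<longleftrightarrow> g \<noteq> {#} \<and> (\<exists>!P. P \<in># g \<and> dg P = d_minus dg g)"

definition P_min :: "('p \<Rightarrow> nat) \<Rightarrow> 'p multiset \<Rightarrow> 'p" where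
  "P_min dg g = (THE P. P \<in># g \<and> dg P = d_minus dg g)"

definition Dset :: "('p \<Rightarrow> nat) \<Rightarrow> 'p set \<Rightarrow> 'p multiset set" where
  "Dset dg S = {g. distinguishable dg g \<and> P_min dg g \<in> S} \<union> {{#}}"

definition Q_S :: "('p \<Rightarrow> nat) \<Rightarrow> 'p set \<Rightarrow> 'p multiset \<Rightarrow> nat" where
  "Q_S dg S g = card {P \<in> S. P \<in># g \<and> dg P = d_plus dg g}"

definition mu_G :: "'p multiset \<Rightarrow> int" where
  "mu_G g = (if \<forall>P. count g P \<le> 1 then (-1) ^ size g else 0)"

definition conv_mu :: "('p multiset \<Rightarrow> complex) \<Rightarrow> 'p multiset \<Rightarrow> complex" where
  "conv_mu a g = (\<Sum>h\<in>{h. h \<subseteq># g}. of_int (mu_G h) * a (g - h))"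

definition natural_density :: "('p \<Rightarrow> nat) \<Rightarrow> 'p set \<Rightarrow> real \<Rightarrow> bool" where
  "natural_density dg S \<delta> \<longleftrightarrow>
     ((\<lambda>n. real (card {P \<in> S. dg P = n}) / real (card {P. dg P = n})) \<longlonglongrightarrow> \<delta>)"

end

theory Submission
  imports Defs "HOL-Complex_Analysis.Complex_Analysis" "HOL-Real_Asymp.Real_Asymp"
begin

text \<open>
  Normalise all generating functions by \<open>q ^ deg\<close>, so that \<open>Z\<close> has its pole at \<open>1\<close>, and let \<open>M = 1 / Z\<close> be
  the generating function of the Moebius function. Sorting by the maximal and by the minimal prime shows
  that the generating function \<open>A\<close> of the sums in (i) and the generating function \<open>B\<close> of the terms in (ii)
  satisfy \<open>A = - Z B\<close>. The function \<open>H(z) = (1 - z) Z(z)\<close> is holomorphic beyond the closed unit disc and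
  has no zero on it: \<open>H(1) = c\<close>, \<open>H(-1)\<close> is nonzero by assumption, and the remaining points of the circle
  are handled by the 3-4-1 inequality. Hence the coefficients of both \<open>H\<close> and \<open>1 / H\<close> are absolutely
  summable. As \<open>A = - H (B / (1 - z))\<close> and \<open>B / (1 - z) = - (1 / H) A\<close>, where the coefficients of
  \<open>B / (1 - z)\<close> are the partial sums in (ii), the limits in (i) and (ii) determine each other.

  The difference of the partial sums in (iii) and (ii) is a sum over \<open>h \<noteq> e\<close> of \<open>a(h) / q ^ deg h\<close> times a
  partial sum over the \<open>r\<close> with \<open>h + r\<close> distinguishable. The latter is a combination of partial sums of the
  Moebius function over elements coprime to a finite set of primes; these are uniformly bounded and tend
  to \<open>0\<close>, since they arise by convolving the summable coefficients of \<open>1 / H\<close> with a bounded null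
  sequence. A Mertens-type bound makes \<open>log log\<close> a dominating weight, and dominated convergence shows
  that the difference tends to \<open>0\<close>.
\<close>

subsection \<open>Power series and asymptotics\<close>

lemma smallo_diff_iff_quotient_tendsto:
  fixes f g :: "nat \<Rightarrow> 'a :: real_normed_field"
  assumes "\<And>n. g n \<noteq> 0"
  shows "(\<lambda>n. f n - l * g n) \<in> o(g) \<longleftrightarrow> (\<lambda>n. f n / g n) \<longlonglongrightarrow> l"
proof -
  have "(\<lambda>n. f n - l * g n) \<in> o(g) \<longleftrightarrow> (\<lambda>n. (f n - l * g n) / g n) \<longlonglongrightarrow> 0"
    using assms by (auto intro: smalloI_tendsto dest: smalloD_tendsto)
  also have "(\<lambda>n. (f n - l * g n) / g n) = (\<lambda>n. f n / g n - l)"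
    using assms by (simp add: diff_divide_distrib)
  finally show ?thesis by (simp add: LIM_zero_iff)
qed

lemma fps_divide_one_minus_X_nth:
  "fps_nth (F / (1 - fps_X)) n = (\<Sum>i\<le>n. fps_nth F i)" for F :: "'a::division_ring fps"
  by (simp add: fps_divide_fps_X_minus1_sum atLeast0AtMost)

lemma fps_uminus_nth_tendsto:
  fixes F :: "'a :: topological_ab_group_add fps"
  assumes "fps_nth F \<longlonglongrightarrow> l"
  shows "fps_nth (- F) \<longlonglongrightarrow> - l"
  using tendsto_minus[OF assms] by (simp flip: fps_neg_nth)

lemma fps_mult_nth_tendsto:
  fixes F G :: "'a :: {banach, real_normed_algebra} fps"
  assumes summable: "summable (\<lambda>n. norm (fps_nth F n))" and lim: "fps_nth G \<longlonglongrightarrow> l"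
  shows "fps_nth (F * G) \<longlonglongrightarrow> suminf (fps_nth F) * l"
proof -
  define t where "t k n = (if k \<le> n then fps_nth F k * fps_nth G (n - k) else 0)" for k n
  obtain B where "B > 0" and B: "\<And>n. norm (fps_nth G n) \<le> B"
    using convergent_imp_Bseq[OF convergentI[OF lim]] by (metis BseqE)
  have "(\<lambda>n. suminf (\<lambda>k. t k n)) \<longlonglongrightarrow> suminf (\<lambda>k. fps_nth F k * l)"
  proof (rule conjunct2[OF conjunct2[OF tannerys_theorem[where M = "\<lambda>k. norm (fps_nth F k) * B"]]])
    fix k
    have "(\<lambda>n. fps_nth G (n - k)) \<longlonglongrightarrow> l"
      using lim by (simp add: LIMSEQ_offset[where k = k])
    then have "(\<lambda>n. fps_nth F k * fps_nth G (n - k)) \<longlonglongrightarrow> fps_nth F k * l"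
      by (rule tendsto_mult_left)
    moreover have "\<forall>\<^sub>F n in sequentially. fps_nth F k * fps_nth G (n - k) = t k n"
      using eventually_ge_at_top[of k] by eventually_elim (simp add: t_def)
    ultimately show "(\<lambda>n. t k n) \<longlonglongrightarrow> fps_nth F k * l"
      by (rule Lim_transform_eventually)
    have "norm (t k n) \<le> norm (fps_nth F k) * B" for k n
      using \<open>B > 0\<close> order.trans[OF norm_mult_ineq mult_left_mono[OF B]] by (simp add: t_def)
    then show "\<forall>\<^sub>F (k, n) in sequentially \<times>\<^sub>F sequentially. norm (t k n) \<le> norm (fps_nth F k) * B"
      by (intro always_eventually) auto
  qed (use summable in \<open>auto intro: summable_mult2\<close>)
  moreover have "suminf (\<lambda>k. t k n) = fps_nth (F * G) n" for n
    by (subst suminf_finite[of "{0..n}"]) (auto simp: t_def fps_mult_nth)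
  moreover have "suminf (\<lambda>k. fps_nth F k * l) = suminf (fps_nth F) * l"
    using summable_norm_cancel[OF summable] by (rule suminf_mult2[symmetric])
  ultimately show ?thesis by simp
qed

lemma norm_fps_mult_nth_le:
  fixes F G :: "'a :: real_normed_algebra fps"
  assumes summable: "summable (\<lambda>n. norm (fps_nth F n))" and bound: "\<And>n. norm (fps_nth G n) \<le> B"
  shows "norm (fps_nth (F * G) n) \<le> (\<Sum>n. norm (fps_nth F n)) * B"
proof -
  have "B \<ge> 0" using order.trans[OF norm_ge_zero bound] .
  have "norm (fps_nth (F * G) n) \<le> (\<Sum>i=0..n. norm (fps_nth F i) * B)"
    unfolding fps_mult_nth
    by (intro order.trans[OF norm_sum] sum_mono order.trans[OF norm_mult_ineq] mult_left_mono bound) simp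
  also have "\<dots> \<le> (\<Sum>n. norm (fps_nth F n)) * B"
    unfolding sum_distrib_right[symmetric]
    using summable \<open>B \<ge> 0\<close> by (intro mult_right_mono sum_le_suminf) auto
  finally show ?thesis .
qed

lemma fps_conv_radius_ge_geometric:
  fixes F :: "'a :: {banach, real_normed_div_algebra} fps"
  assumes bound: "\<And>n. norm (fps_nth F n) \<le> C * x ^ n" and x: "x > 0"
  shows "fps_conv_radius F \<ge> 1 / x"
  unfolding fps_conv_radius_def
proof (rule conv_radius_geI_ex')
  fix r :: real assume r: "0 < r" "ereal r < ereal (1 / x)"
  then have "norm (x * r) < 1" using x by (simp add: field_simps)
  then have "summable (\<lambda>n. C * (x * r) ^ n)"
    by (intro summable_mult summable_geometric)
  moreover have "norm (fps_nth F n * of_real r ^ n) \<le> C * (x * r) ^ n" for n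
    using mult_right_mono[OF bound[of n], of "r ^ n"] r
    by (simp add: norm_mult norm_power power_mult_distrib)
  ultimately show "summable (\<lambda>n. fps_nth F n * of_real r ^ n)"
    by (rule summable_comparison_test')
qed

subsection \<open>Nonvanishing\<close>

lemma continuous_nonzero_beyond_cball:
  fixes f :: "'a :: {heine_borel, real_normed_vector} \<Rightarrow> 'b :: real_normed_vector"
  assumes cont: "continuous_on (ball 0 R) f" and "r < R" and nz: "\<And>z. norm z \<le> r \<Longrightarrow> f z \<noteq> 0"
  obtains r' where "r < r'" "\<And>z. norm z < r' \<Longrightarrow> f z \<noteq> 0"
proof -
  obtain s where s: "r < s" "s < R" using dense[OF \<open>r < R\<close>] by blast
  let ?zeros = "{z \<in> cball 0 s. f z = 0}"
  show thesis
  proof (cases "?zeros = {}")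
    case True
    then have "f z \<noteq> 0" if "norm z < s" for z using that by auto
    then show thesis using that s by blast
  next
    case False
    have "continuous_on (cball 0 s) f"
      using s by (intro continuous_on_subset[OF cont]) auto
    then have "closed ?zeros"
      by (rule continuous_closed_preimage_constant) simp
    then have "compact (cball 0 s \<inter> ?zeros)"
      by (rule compact_Int_closed[OF compact_cball])
    then have "compact ?zeros" by (simp add: Int_def conj_commute cong: conj_cong)
    then obtain z\<^sub>0 where z\<^sub>0: "z\<^sub>0 \<in> ?zeros" "\<And>z. z \<in> ?zeros \<Longrightarrow> norm z\<^sub>0 \<le> norm z"
      using continuous_attains_inf[OF _ False continuous_on_norm_id] by blast
    show thesis
    proof
      show "r < norm z\<^sub>0" using z\<^sub>0(1) nz[of z\<^sub>0] by fastforce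
      show "f z \<noteq> 0" if "norm z < norm z\<^sub>0" for z
        using z\<^sub>0(1) z\<^sub>0(2)[of z] that by auto
    qed
  qed
qed

lemma ln_norm_one_minus_sums:
  fixes w :: complex
  assumes "norm w < 1"
  shows "(\<lambda>n. - Re (w ^ n) / real n) sums ln (norm (1 - w))"
proof -
  have "(\<lambda>n. - (w ^ n) / of_nat n) sums ln (1 - w)"
    using Ln_series'[of "-w"] assms by simp
  then have "(\<lambda>n. Re (- (w ^ n) / of_nat n)) sums Re (ln (1 - w))"
    by (rule sums_Re)
  moreover have "w \<noteq> 1" using assms by auto
  ultimately show ?thesis by (simp add: Re_divide_of_nat)
qed

lemma three_plus_four_Re_plus_Re_power2:
  fixes v :: complex
  assumes "norm v = 1"
  shows "3 + 4 * Re v + Re (v\<^sup>2) = 2 * (1 + Re v)\<^sup>2"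
proof -
  have "(Re v)\<^sup>2 + (Im v)\<^sup>2 = 1" using assms by (simp add: cmod_def)
  then show ?thesis by (simp add: power2_eq_square algebra_simps)
qed

definition three_four_one :: "(complex \<Rightarrow> complex) \<Rightarrow> real \<Rightarrow> complex \<Rightarrow> real" where
  "three_four_one F x u =
    norm (F (of_real x)) ^ 3 * norm (F (of_real x * u)) ^ 4 * norm (F (of_real x * u\<^sup>2))"

lemma three_four_one_nonneg: "three_four_one F x u \<ge> 0"
  by (simp add: three_four_one_def)

lemma three_four_one_mult:
  "three_four_one (\<lambda>z. F z * G z) x u = three_four_one F x u * three_four_one G x u"
  by (simp add: three_four_one_def norm_mult power_mult_distrib mult_ac)

lemma three_four_one_prod:
  "three_four_one (\<lambda>z. \<Prod>i\<in>I. F i z) x u = (\<Prod>i\<in>I. three_four_one (F i) x u)"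
  by (simp add: three_four_one_def prod.distrib prod_power_distrib flip: prod_norm)

lemma three_four_one_one_minus_le_1:
  assumes r: "0 \<le> r" "r < 1" and u: "norm u = 1"
  shows "three_four_one (\<lambda>z. 1 - z) r u \<le> 1"
proof -
  let ?x = "norm (1 - of_real r :: complex)" and ?y = "norm (1 - of_real r * u)"
    and ?z = "norm (1 - of_real r * u\<^sup>2)"
  have small: "norm (complex_of_real r) < 1" "norm (of_real r * u) < 1" "norm (of_real r * u\<^sup>2) < 1"
    using r u by (auto simp: norm_mult norm_power)
  then have pos: "?x > 0" "?y > 0" "?z > 0" by auto
  let ?t = "\<lambda>n. 3 * (- Re (of_real r ^ n) / real n) + 4 * (- Re ((of_real r * u) ^ n) / real n)
      + (- Re ((of_real r * u\<^sup>2) ^ n) / real n)"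
  have "?t sums (3 * ln ?x + 4 * ln ?y + ln ?z)"
    by (intro sums_add sums_mult ln_norm_one_minus_sums small)
  moreover have "?t n \<le> 0" for n
  proof -
    have "norm (u ^ n) = 1" using u by (simp add: norm_power)
    then have "3 + 4 * Re (u ^ n) + Re ((u ^ n)\<^sup>2) = 2 * (1 + Re (u ^ n))\<^sup>2"
      by (rule three_plus_four_Re_plus_Re_power2)
    moreover have "?t n = - (r ^ n * (3 + 4 * Re (u ^ n) + Re ((u ^ n)\<^sup>2)) / real n)"
      by (simp add: power_mult_distrib power_commutes diff_divide_distrib add_divide_distrib
          algebra_simps flip: of_real_power power_mult)
    ultimately show ?thesis using r by simp
  qed
  ultimately have "3 * ln ?x + 4 * ln ?y + ln ?z \<le> 0"
    by (rule sums_le[OF _ _ sums_zero, rotated])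
  then have "ln (?x ^ 3 * ?y ^ 4 * ?z) \<le> 0"
    using pos by (simp add: ln_mult ln_realpow)
  then show ?thesis using pos by (simp add: three_four_one_def ln_le_zero_iff)
qed

lemma nonzero_if_three_four_one_ge:
  assumes deriv: "(F has_field_derivative D) (at u)" and cont: "isCont F 1" "isCont F (u\<^sup>2)"
    and u: "norm u = 1" "u \<noteq> 1" "u \<noteq> -1"
    and ge: "\<And>x. 0 < x \<Longrightarrow> x < 1 \<Longrightarrow> three_four_one (\<lambda>z. 1 - z) x u \<le> three_four_one F x u"
  shows "F u \<noteq> 0"
proof
  assume "F u = 0"
  then obtain G where G: "\<And>z. F z = G z * (z - u)" "isCont G u"
    using deriv unfolding CARAT_DERIV by auto
  let ?lower = "\<lambda>x. norm (1 - of_real x * u) ^ 4 * norm (1 - of_real x * u\<^sup>2)"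
  let ?upper = "\<lambda>x. norm (F (of_real x)) ^ 3 * norm (G (of_real x * u)) ^ 4 * norm (F (of_real x * u\<^sup>2)) * (1 - x)"
  have lower_le_upper: "?lower x \<le> ?upper x" if x: "0 < x" "x < 1" for x :: real
  proof -
    have "of_real x * u - u = of_real (x - 1) * u" by (simp add: algebra_simps)
    then have "norm (of_real x * u - u) = 1 - x"
      using u x by (simp only: norm_mult norm_of_real) simp
    then have "norm (F (of_real x * u)) = norm (G (of_real x * u)) * (1 - x)"
      by (simp add: G(1) norm_mult)
    moreover have "norm (1 - complex_of_real x) = 1 - x"
      using x by (metis abs_of_pos diff_gt_0_iff_gt norm_of_real of_real_1 of_real_diff)
    ultimately have "(1 - x) ^ 3 * ?lower x \<le> (1 - x) ^ 3 * ?upper x"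
      using ge[OF x] by (simp add: three_four_one_def power_mult_distrib mult_ac power_numeral_reduce)
    then show ?thesis using x by simp
  qed
  have radial_limit: "((\<lambda>x. of_real x * v) \<longlongrightarrow> v) (at_left (1::real))" for v :: complex
    by (rule tendsto_eq_intros refl | simp)+
  have "norm (1 - u) ^ 4 * norm (1 - u\<^sup>2) \<le> norm (F 1) ^ 3 * norm (G u) ^ 4 * norm (F (u\<^sup>2)) * (1 - 1)"
  proof (rule tendsto_le)
    show "(?lower \<longlongrightarrow> norm (1 - u) ^ 4 * norm (1 - u\<^sup>2)) (at_left 1)"
      by (intro tendsto_intros radial_limit)
    show "(?upper \<longlongrightarrow> norm (F 1) ^ 3 * norm (G u) ^ 4 * norm (F (u\<^sup>2)) * (1 - 1)) (at_left 1)"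
      using radial_limit[of 1]
      by (intro tendsto_intros isCont_tendsto_compose[OF cont(1)] isCont_tendsto_compose[OF cont(2)]
          isCont_tendsto_compose[OF G(2)] radial_limit) simp
    show "\<forall>\<^sub>F x in at_left 1. ?lower x \<le> ?upper x"
      by (rule eventually_mono[OF eventually_at_left_real[of 0 1]]) (auto intro: lower_le_upper)
  qed simp
  moreover have "norm (1 - u) ^ 4 * norm (1 - u\<^sup>2) > 0"
    using u by (auto simp: power2_eq_1_iff)
  ultimately show False by simp
qed

subsection \<open>Generating functions of a graded free commutative monoid\<close>

lemma degG_empty [simp]: "degG dg {#} = 0"
  and degG_add [simp]: "degG dg (g + h) = degG dg g + degG dg h"
  and degG_add_mset [simp]: "degG dg (add_mset P g) = dg P + degG dg g"
  by (simp_all add: degG_def)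

lemma mu_G_empty [simp]: "mu_G {#} = 1"
  by (simp add: mu_G_def)

lemma mu_G_add_disjoint:
  assumes "set_mset g \<inter> set_mset h = {}"
  shows "mu_G (g + h) = mu_G g * mu_G h"
proof -
  have "count g P = 0 \<or> count h P = 0" for P
    using assms by (auto simp: count_eq_zero_iff)
  then have "count (g + h) P \<le> 1 \<longleftrightarrow> count g P \<le> 1 \<and> count h P \<le> 1" for P
    by (metis add_0 add_cancel_left_right count_union le0)
  then show ?thesis by (auto simp: mu_G_def power_add)
qed

lemma mu_G_add_mset: "P \<notin># g \<Longrightarrow> mu_G (add_mset P g) = - mu_G g"
  using mu_G_add_disjoint[of "{#P#}" g] by (simp add: mu_G_def[of "{#P#}"])

lemma mu_G_add_mset_eq_0: "P \<in># g \<Longrightarrow> mu_G (add_mset P g) = 0"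
  by (auto simp: mu_G_def intro!: exI[of _ P])

lemma norm_mu_G_le: "norm (of_int (mu_G g) :: complex) \<le> 1"
  by (auto simp: mu_G_def norm_power)

definition free_on :: "'p set \<Rightarrow> 'p multiset set" where
  "free_on A = {g. set_mset g \<subseteq> A}"

lemma free_on_empty [simp]: "free_on {} = {{#}}"
  and free_on_UNIV [simp]: "free_on UNIV = UNIV"
  by (auto simp: free_on_def)

lemma bij_betw_free_on_Un:
  assumes "A \<inter> B = {}"
  shows "bij_betw (\<lambda>(h, r). h + r) (free_on A \<times> free_on B) (free_on (A \<union> B))"
proof (rule bij_betw_byWitness[where f' = "\<lambda>g. (filter_mset (\<lambda>P. P \<in> A) g, filter_mset (\<lambda>P. P \<notin> A) g)"])
  have "filter_mset (\<lambda>P. P \<in> A) (h + r) = h \<and> filter_mset (\<lambda>P. P \<notin> A) (h + r) = r"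
    if "h \<in> free_on A" "r \<in> free_on B" for h r
  proof -
    have "filter_mset (\<lambda>P. P \<in> A) h = h" "filter_mset (\<lambda>P. P \<in> A) r = {#}"
      "filter_mset (\<lambda>P. P \<notin> A) h = {#}" "filter_mset (\<lambda>P. P \<notin> A) r = r"
      using that assms by (auto simp: free_on_def filter_mset_eq_conv filter_mset_eq_mempty_iff)
    then show ?thesis by simp
  qed
  then show "\<forall>p\<in>free_on A \<times> free_on B. (filter_mset (\<lambda>P. P \<in> A) (case p of (h, r) \<Rightarrow> h + r),
      filter_mset (\<lambda>P. P \<notin> A) (case p of (h, r) \<Rightarrow> h + r)) = p"
    by auto
qed (auto simp: free_on_def)

locale graded_primes =
  fixes dg :: "'p \<Rightarrow> nat" and q :: real
  assumes dg_pos: "dg P > 0" and finite_dg: "finite {P. dg P = n}" and q_gt_1: "q > 1"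
begin

abbreviation deg :: "'p multiset \<Rightarrow> nat" where "deg \<equiv> degG dg"

lemma q_pos: "q > 0" and q_nonzero [simp]: "q \<noteq> 0"
  using q_gt_1 by auto

lemma finite_dg_le: "finite {P. dg P \<le> n}"
proof -
  have "{P. dg P \<le> n} = (\<Union>m\<le>n. {P. dg P = m})" by auto
  then show ?thesis using finite_dg by simp
qed

lemma finite_dg_le_on: "finite {P \<in> S. dg P \<le> n}"
  by (rule finite_subset[OF _ finite_dg_le[of n]]) auto

lemma dg_le_deg: "P \<in># g \<Longrightarrow> dg P \<le> deg g"
  by (metis degG_add_mset insert_DiffM le_add1)

lemma size_le_deg: "size g \<le> deg g"
proof (induction g)
  case (add P g)
  then show ?case using dg_pos[of P] by simp
qed simp

lemma deg_eq_0_iff [simp]: "deg g = 0 \<longleftrightarrow> g = {#}"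
  using size_le_deg[of g] by auto

lemma finite_deg_le: "finite {g. deg g \<le> n}"
proof (rule finite_subset)
  show "{g. deg g \<le> n} \<subseteq> (\<Union>m\<le>n. multisets_of_size {P. dg P \<le> n} m)"
  proof
    fix g assume "g \<in> {g. deg g \<le> n}"
    then have "size g \<le> n" "\<forall>P\<in>set_mset g. dg P \<le> n"
      using size_le_deg[of g] dg_le_deg[of _ g] by force+
    then show "g \<in> (\<Union>m\<le>n. multisets_of_size {P. dg P \<le> n} m)"
      by (auto simp: multisets_of_size_def)
  qed
  show "finite (\<Union>m\<le>n. multisets_of_size {P. dg P \<le> n} m)"
    by (auto intro!: finite_multisets_of_size finite_dg_le)
qed

lemma finite_deg_le_restrict [simp]: "finite {g. R g \<and> deg g \<le> n}"
  and finite_deg_eq_restrict [simp]: "finite {g. R g \<and> deg g = n}"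
  by (rule finite_subset[OF _ finite_deg_le[of n]], force)+

lemma sum_deg_le_eq_sum_deg_eq:
  fixes w :: "'p multiset \<Rightarrow> 'b::comm_monoid_add"
  shows "(\<Sum>g\<in>{g \<in> X. deg g \<le> n}. w g) = (\<Sum>m\<le>n. \<Sum>g\<in>{g \<in> X. deg g = m}. w g)"
proof -
  have "(\<Sum>g\<in>{g \<in> X. deg g \<le> n}. w g) = (\<Sum>m\<le>n. \<Sum>g\<in>{g \<in> {g \<in> X. deg g \<le> n}. deg g = m}. w g)"
    by (rule sum.group[symmetric]) auto
  also have "\<dots> = (\<Sum>m\<le>n. \<Sum>g\<in>{g \<in> X. deg g = m}. w g)"
    by (intro sum.cong refl) auto
  finally show ?thesis .
qed

definition gen_fps :: "('p multiset \<Rightarrow> complex) \<Rightarrow> 'p multiset set \<Rightarrow> complex fps" where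
  "gen_fps w X = Abs_fps (\<lambda>n. (\<Sum>g\<in>{g \<in> X. deg g = n}. w g) / of_real q ^ n)"

lemma gen_fps_nth: "fps_nth (gen_fps w X) n = (\<Sum>g\<in>{g \<in> X. deg g = n}. w g) / of_real q ^ n"
  by (simp add: gen_fps_def)

lemma gen_fps_partial_sum:
  "fps_nth (gen_fps w X / (1 - fps_X)) n = (\<Sum>g\<in>{g \<in> X. deg g \<le> n}. w g / complex_of_real (q ^ deg g))"
  by (simp add: fps_divide_one_minus_X_nth gen_fps_nth sum_deg_le_eq_sum_deg_eq sum_divide_distrib)

lemma gen_fps_nth_cong:
  assumes "\<And>g. deg g = n \<Longrightarrow> g \<in> X \<Longrightarrow> g \<in> Y \<or> w g = 0"
    and "\<And>g. deg g = n \<Longrightarrow> g \<in> Y \<Longrightarrow> g \<in> X \<or> v g = 0"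
    and "\<And>g. deg g = n \<Longrightarrow> g \<in> X \<Longrightarrow> g \<in> Y \<Longrightarrow> w g = v g"
  shows "fps_nth (gen_fps w X) n = fps_nth (gen_fps v Y) n"
proof -
  have "(\<Sum>g\<in>{g \<in> X. deg g = n}. w g) = (\<Sum>g\<in>{g \<in> Y. deg g = n}. v g)"
    by (rule sum.mono_neutral_cong) (use assms in auto)
  then show ?thesis by (simp add: gen_fps_nth)
qed

lemma gen_fps_cong:
  assumes "\<And>g. g \<in> X \<Longrightarrow> g \<in> Y \<or> w g = 0"
    and "\<And>g. g \<in> Y \<Longrightarrow> g \<in> X \<or> v g = 0"
    and "\<And>g. g \<in> X \<Longrightarrow> g \<in> Y \<Longrightarrow> w g = v g"
  shows "gen_fps w X = gen_fps v Y"
  by (rule fps_ext, rule gen_fps_nth_cong) (use assms in blast)+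

lemma gen_fps_cmult: "gen_fps (\<lambda>g. k * w g) X = fps_const k * gen_fps w X"
  by (simp add: fps_eq_iff gen_fps_nth sum_distrib_left)

lemma gen_fps_UN_nth:
  assumes disj: "disjoint_family_on X I" and J: "finite J" "J \<subseteq> I"
    and deg_in_J: "\<And>i g. i \<in> I \<Longrightarrow> g \<in> X i \<Longrightarrow> deg g = n \<Longrightarrow> i \<in> J"
  shows "fps_nth (gen_fps w (\<Union>i\<in>I. X i)) n = (\<Sum>i\<in>J. fps_nth (gen_fps w (X i)) n)"
proof -
  have "{g \<in> (\<Union>i\<in>I. X i). deg g = n} = (\<Union>i\<in>J. {g \<in> X i. deg g = n})"
    using J deg_in_J by auto
  moreover have "\<forall>i\<in>J. \<forall>j\<in>J. i \<noteq> j \<longrightarrow> {g \<in> X i. deg g = n} \<inter> {g \<in> X j. deg g = n} = {}"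
    using disj J(2) by (fastforce simp: disjoint_family_on_def)
  ultimately have "(\<Sum>g\<in>{g \<in> (\<Union>i\<in>I. X i). deg g = n}. w g) = (\<Sum>i\<in>J. \<Sum>g\<in>{g \<in> X i. deg g = n}. w g)"
    using J(1) by (simp add: sum.UNION_disjoint)
  then show ?thesis by (simp add: gen_fps_nth sum_divide_distrib)
qed

lemma gen_fps_UN:
  assumes "finite I" and "disjoint_family_on X I"
  shows "gen_fps w (\<Union>i\<in>I. X i) = (\<Sum>i\<in>I. gen_fps w (X i))"
  by (rule fps_ext) (use assms in \<open>simp add: gen_fps_UN_nth[where J = I] fps_sum_nth\<close>)

lemma gen_fps_Un:
  assumes "X \<inter> Y = {}"
  shows "gen_fps w (X \<union> Y) = gen_fps w X + gen_fps w Y"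
proof -
  have "disjoint_family (\<lambda>b. if b then X else Y)"
    using assms by (auto simp: disjoint_family_on_def)
  from gen_fps_UN[OF finite this, of w] show ?thesis by (simp add: UNIV_bool Un_commute)
qed

lemma gen_fps_singleton: "gen_fps w {g} = fps_const (w g / of_real q ^ deg g) * fps_X ^ deg g"
proof (rule fps_ext)
  fix n
  have "{h \<in> {g}. deg h = n} = (if deg g = n then {g} else {})" by auto
  then show "fps_nth (gen_fps w {g}) n = fps_nth (fps_const (w g / of_real q ^ deg g) * fps_X ^ deg g) n"
    by (auto simp: gen_fps_nth fps_X_power_nth)
qed

lemma gen_fps_mult:
  assumes bij: "bij_betw (\<lambda>(h, r). h + r) (X \<times> Y) Z"
    and weight_add: "\<And>h r. h \<in> X \<Longrightarrow> r \<in> Y \<Longrightarrow> w (h + r) = u h * v r"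
  shows "gen_fps u X * gen_fps v Y = gen_fps w Z"
proof (rule fps_ext)
  fix n
  define T where "T = {p \<in> X \<times> Y. deg (fst p) + deg (snd p) = n}"
  have bij_T: "bij_betw (\<lambda>(h, r). h + r) T {g \<in> Z. deg g = n}"
    by (rule bij_betw_subset[OF bij]) (auto simp: T_def simp flip: bij_betw_imp_surj_on[OF bij])
  then have "finite T" by (simp add: bij_betw_finite)
  have fibre: "{p \<in> T. deg (fst p) = i} = {h \<in> X. deg h = i} \<times> {r \<in> Y. deg r = n - i}" if "i \<le> n" for i
    using that by (auto simp: T_def)
  have "(\<Sum>g\<in>{g \<in> Z. deg g = n}. w g) = (\<Sum>(h, r)\<in>T. w (h + r))"
    using sum.reindex_bij_betw[OF bij_T, of w] by (simp add: case_prod_unfold)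
  also have "\<dots> = (\<Sum>(h, r)\<in>T. u h * v r)"
    by (rule sum.cong) (auto simp: T_def weight_add)
  also have "\<dots> = (\<Sum>i=0..n. \<Sum>(h, r)\<in>{p \<in> T. deg (fst p) = i}. u h * v r)"
    by (rule sum.group[symmetric]) (use \<open>finite T\<close> in \<open>auto simp: T_def\<close>)
  also have "\<dots> = (\<Sum>i=0..n. (\<Sum>h\<in>{h \<in> X. deg h = i}. u h) * (\<Sum>r\<in>{r \<in> Y. deg r = n - i}. v r))"
    by (intro sum.cong refl) (simp add: fibre sum_product sum.cartesian_product)
  finally have "fps_nth (gen_fps w Z) n =
      (\<Sum>i=0..n. (\<Sum>h\<in>{h \<in> X. deg h = i}. u h) * (\<Sum>r\<in>{r \<in> Y. deg r = n - i}. v r) / of_real q ^ n)"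
    by (simp add: gen_fps_nth sum_divide_distrib)
  also have "\<dots> = fps_nth (gen_fps u X * gen_fps v Y) n"
    unfolding fps_mult_nth by (intro sum.cong refl) (simp add: gen_fps_nth flip: power_add)
  finally show "fps_nth (gen_fps u X * gen_fps v Y) n = fps_nth (gen_fps w Z) n" ..
qed

lemma norm_gen_fps_nth_le:
  assumes "\<And>g. norm (w g) \<le> 1"
  shows "norm (fps_nth (gen_fps w X) n) \<le> norm (fps_nth (gen_fps (\<lambda>_. 1) X) n)"
proof -
  have "norm (\<Sum>g\<in>{g \<in> X. deg g = n}. w g) \<le> (\<Sum>g\<in>{g \<in> X. deg g = n}. 1)"
    by (intro order.trans[OF norm_sum] sum_mono assms)
  then show ?thesis
    using q_pos by (simp add: gen_fps_nth norm_divide norm_power divide_right_mono)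
qed

definition prime_fps :: "'p \<Rightarrow> complex fps" where
  "prime_fps P = fps_of_poly (monom (1 / of_real q ^ dg P) (dg P))"

lemma prime_fps_mult_nth:
  "fps_nth (prime_fps P * F) n = (if dg P \<le> n then fps_nth F (n - dg P) / of_real q ^ dg P else 0)"
  by (simp add: prime_fps_def fps_of_poly_monom mult.assoc fps_X_power_mult_nth)

lemma norm_prime_fps_mult_nth_le:
  assumes "\<And>n. norm (fps_nth F n) \<le> B"
  shows "norm (fps_nth (prime_fps P * F) n) \<le> B / q ^ dg P"
proof -
  have "B \<ge> 0" using order.trans[OF norm_ge_zero assms] .
  then show ?thesis
    using assms q_pos by (auto simp: prime_fps_mult_nth norm_divide norm_power divide_right_mono)
qed

lemma prime_fps_mult_tendsto_0:
  assumes "fps_nth F \<longlonglongrightarrow> 0"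
  shows "fps_nth (prime_fps P * F) \<longlonglongrightarrow> 0"
proof (rule LIMSEQ_offset[where k = "dg P"])
  have "(\<lambda>n. fps_nth F n / of_real q ^ dg P) \<longlonglongrightarrow> 0 / of_real q ^ dg P"
    by (intro tendsto_intros assms) simp
  then show "(\<lambda>n. fps_nth (prime_fps P * F) (n + dg P)) \<longlonglongrightarrow> 0"
    by (simp add: prime_fps_mult_nth)
qed

lemma gen_fps_add_mset:
  assumes "\<And>r. r \<in> Y \<Longrightarrow> w (add_mset P r) = v r"
  shows "gen_fps w (add_mset P ` Y) = prime_fps P * gen_fps v Y"
proof -
  have "bij_betw (\<lambda>(h, r). h + r) ({{#P#}} \<times> Y) (add_mset P ` Y)"
    by (auto simp: bij_betw_def inj_on_def image_iff)
  then have "gen_fps (\<lambda>_. 1) {{#P#}} * gen_fps v Y = gen_fps w (add_mset P ` Y)"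
    by (rule gen_fps_mult) (auto simp: assms)
  moreover have "gen_fps (\<lambda>_. 1) {{#P#}} = prime_fps P"
    by (simp add: gen_fps_singleton prime_fps_def fps_of_poly_monom)
  ultimately show ?thesis by simp
qed

definition zeta_fps :: "'p set \<Rightarrow> complex fps" where
  "zeta_fps A = gen_fps (\<lambda>_. 1) (free_on A)"

definition moebius_fps :: "'p set \<Rightarrow> complex fps" where
  "moebius_fps A = gen_fps (\<lambda>g. of_int (mu_G g)) (free_on A)"

lemma norm_zeta_fps_nth: "norm (fps_nth (zeta_fps A) n) = real (card {g \<in> free_on A. deg g = n}) / q ^ n"
  using q_pos by (simp add: zeta_fps_def gen_fps_nth norm_divide norm_power)

lemma norm_zeta_fps_nth_mono: "A \<subseteq> B \<Longrightarrow> norm (fps_nth (zeta_fps A) n) \<le> norm (fps_nth (zeta_fps B) n)"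
  unfolding norm_zeta_fps_nth using q_pos
  by (intro divide_right_mono of_nat_mono card_mono) (auto simp: free_on_def)

lemma norm_moebius_fps_nth_le: "norm (fps_nth (moebius_fps A) n) \<le> norm (fps_nth (zeta_fps A) n)"
  unfolding moebius_fps_def zeta_fps_def by (rule norm_gen_fps_nth_le) (rule norm_mu_G_le)

lemma zeta_fps_empty [simp]: "zeta_fps {} = 1" and moebius_fps_empty [simp]: "moebius_fps {} = 1"
  by (simp_all add: zeta_fps_def moebius_fps_def gen_fps_singleton)

lemma zeta_fps_Un: "A \<inter> B = {} \<Longrightarrow> zeta_fps (A \<union> B) = zeta_fps A * zeta_fps B"
  unfolding zeta_fps_def by (rule sym, rule gen_fps_mult[OF bij_betw_free_on_Un]) auto

lemma moebius_fps_Un: "A \<inter> B = {} \<Longrightarrow> moebius_fps (A \<union> B) = moebius_fps A * moebius_fps B"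
  unfolding moebius_fps_def
  by (rule sym, rule gen_fps_mult[OF bij_betw_free_on_Un], assumption)
    (subst mu_G_add_disjoint, auto simp: free_on_def)

lemma zeta_fps_singleton: "zeta_fps {P} * (1 - prime_fps P) = 1"
proof -
  have "free_on {P} = {{#}} \<union> add_mset P ` free_on {P}"
  proof (intro equalityI subsetI)
    fix g assume "g \<in> free_on {P}"
    then show "g \<in> {{#}} \<union> add_mset P ` free_on {P}"
      by (cases g) (auto simp: free_on_def)
  qed (auto simp: free_on_def)
  then have "zeta_fps {P} = gen_fps (\<lambda>_. 1) ({{#}} \<union> add_mset P ` free_on {P})"
    by (simp add: zeta_fps_def)
  also have "\<dots> = gen_fps (\<lambda>_. 1) {{#}} + gen_fps (\<lambda>_. 1) (add_mset P ` free_on {P})"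
    by (rule gen_fps_Un) auto
  also have "\<dots> = 1 + prime_fps P * zeta_fps {P}"
    by (simp add: gen_fps_singleton gen_fps_add_mset[where v = "\<lambda>_. 1"] zeta_fps_def)
  finally show ?thesis by (simp add: algebra_simps)
qed

lemma moebius_fps_singleton: "moebius_fps {P} = 1 - prime_fps P"
proof -
  have "moebius_fps {P} = gen_fps (\<lambda>g. of_int (mu_G g)) ({{#}} \<union> add_mset P ` {{#}})"
    unfolding moebius_fps_def
  proof (rule gen_fps_cong)
    fix g assume g: "g \<in> free_on {P}"
    show "g \<in> {{#}} \<union> add_mset P ` {{#}} \<or> complex_of_int (mu_G g) = 0"
    proof (cases g)
      case (add P' r)
      then have "P' = P" "r \<in> free_on {P}" using g by (auto simp: free_on_def)
      then show ?thesis
        using add by (cases "P \<in># r") (auto simp: mu_G_add_mset_eq_0 free_on_def subset_singleton_iff)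
    qed simp
  qed (auto simp: free_on_def)
  also have "\<dots> = gen_fps (\<lambda>g. of_int (mu_G g)) {{#}} + gen_fps (\<lambda>g. of_int (mu_G g)) (add_mset P ` {{#}})"
    by (rule gen_fps_Un) auto
  also have "\<dots> = 1 - prime_fps P"
    by (subst gen_fps_add_mset[where v = "\<lambda>_. -1"]) (simp_all add: gen_fps_singleton mu_G_add_mset flip: fps_const_neg)
  finally show ?thesis .
qed

lemma gen_fps_free_on_truncate:
  assumes "n \<le> m"
  shows "fps_nth (gen_fps w (free_on (A \<inter> {P. dg P \<le> m}))) n = fps_nth (gen_fps w (free_on A)) n"
proof (rule gen_fps_nth_cong)
  fix g assume "deg g = n" "g \<in> free_on A"
  moreover from this have "dg P \<le> m" if "P \<in># g" for P
    using dg_le_deg[OF that] assms by simp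
  ultimately show "g \<in> free_on (A \<inter> {P. dg P \<le> m}) \<or> w g = 0"
    by (auto simp: free_on_def)
qed (auto simp: free_on_def)

lemma zeta_fps_mult_moebius_fps: "zeta_fps A * moebius_fps A = 1"
proof (rule fps_ext)
  have finite: "zeta_fps B * moebius_fps B = 1" if "finite B" for B
    using that
  proof (induction B rule: finite_induct)
    case (insert P B)
    have "zeta_fps (insert P B) * moebius_fps (insert P B)
        = (zeta_fps {P} * moebius_fps {P}) * (zeta_fps B * moebius_fps B)"
      using insert.hyps zeta_fps_Un[of "{P}" B] moebius_fps_Un[of "{P}" B] by (simp add: algebra_simps)
    then show ?case using insert by (simp add: moebius_fps_singleton zeta_fps_singleton)
  qed simp
  fix n
  let ?A = "A \<inter> {P. dg P \<le> n}"
  have "fps_nth (zeta_fps A * moebius_fps A) n = fps_nth (zeta_fps ?A * moebius_fps ?A) n"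
    unfolding fps_mult_nth zeta_fps_def moebius_fps_def
    by (intro sum.cong refl) (simp add: gen_fps_free_on_truncate)
  also have "zeta_fps ?A * moebius_fps ?A = 1"
    by (rule finite) (simp add: finite_dg_le)
  finally show "fps_nth (zeta_fps A * moebius_fps A) n = fps_nth 1 n" .
qed

lemma zeta_fps_eq_inverse: "zeta_fps A = inverse (moebius_fps A)"
  by (metis fps_inverse_unique mult.commute zeta_fps_mult_moebius_fps)

lemma zeta_fps_eq_zeta_UNIV_mult: "zeta_fps A = zeta_fps UNIV * moebius_fps (- A)"
proof -
  have "zeta_fps UNIV * moebius_fps (- A) = zeta_fps A * (zeta_fps (- A) * moebius_fps (- A))"
    using zeta_fps_Un[of A "- A"] by (simp add: mult.assoc)
  then show ?thesis by (simp add: zeta_fps_mult_moebius_fps)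
qed

lemma moebius_fps_Compl: "moebius_fps (- A) = moebius_fps UNIV * zeta_fps A"
  using zeta_fps_mult_moebius_fps[of UNIV]
  by (simp add: zeta_fps_eq_zeta_UNIV_mult[of A] mult.commute flip: mult.assoc)

subsubsection \<open>Finite sets of primes\<close>

lemma norm_power_dg_less_1: "norm z < q \<Longrightarrow> norm ((z / of_real q) ^ dg P) < 1" for z :: complex
  using q_pos dg_pos[of P] by (simp add: norm_power norm_divide power_less_one_iff)

lemma moebius_fps_finite:
  assumes "finite A"
  shows "moebius_fps A = fps_of_poly (\<Prod>P\<in>A. 1 - monom (1 / of_real q ^ dg P) (dg P))"
  using assms
proof (induction A rule: finite_induct)
  case (insert P A)
  then show ?case
    using moebius_fps_Un[of "{P}" A]
    by (simp add: moebius_fps_singleton prime_fps_def fps_of_poly_simps)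
qed simp

lemma fps_conv_radius_moebius_fps_finite: "finite A \<Longrightarrow> fps_conv_radius (moebius_fps A) = \<infinity>"
  by (simp add: moebius_fps_finite)

lemma eval_moebius_fps_finite:
  "finite A \<Longrightarrow> eval_fps (moebius_fps A) z = (\<Prod>P\<in>A. 1 - (z / of_real q) ^ dg P)"
  by (simp add: moebius_fps_finite poly_prod poly_monom power_divide)

lemma
  assumes "finite A"
  shows fps_conv_radius_zeta_fps_finite_ge: "fps_conv_radius (zeta_fps A) \<ge> q"
    and eval_zeta_fps_finite: "norm z < q \<Longrightarrow> eval_fps (zeta_fps A) z = (\<Prod>P\<in>A. 1 / (1 - (z / of_real q) ^ dg P))"
proof -
  have "1 - (z / of_real q) ^ dg P \<noteq> 0" if "norm z < q" for z :: complex and P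
    using norm_power_dg_less_1[OF that, of P] by auto
  then have nz: "eval_fps (moebius_fps A) z \<noteq> 0" if "ereal (norm z) < ereal q" for z
    using that assms by (auto simp: eval_moebius_fps_finite)
  show "fps_conv_radius (zeta_fps A) \<ge> q"
    using fps_conv_radius_inverse[of "ereal q" "moebius_fps A", OF nz] q_pos
    by (simp add: zeta_fps_eq_inverse fps_conv_radius_moebius_fps_finite assms)
  show "eval_fps (zeta_fps A) z = (\<Prod>P\<in>A. 1 / (1 - (z / of_real q) ^ dg P))" if "norm z < q"
    using eval_fps_inverse[of "ereal q" "moebius_fps A", OF nz] that q_pos assms
    by (simp add: zeta_fps_eq_inverse fps_conv_radius_moebius_fps_finite eval_moebius_fps_finite
        prod_dividef inverse_eq_divide)
qed

lemma zeta_fps_finite_tendsto_0: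
  assumes "finite A"
  shows "fps_nth (zeta_fps A) \<longlonglongrightarrow> 0"
proof -
  have "norm (1::complex) < fps_conv_radius (zeta_fps A)"
    using q_gt_1 by (intro less_le_trans[OF _ fps_conv_radius_zeta_fps_finite_ge[OF assms]]) simp
  from summable_fps[OF this] show ?thesis by (simp add: summable_LIMSEQ_zero)
qed

end

subsection \<open>The zeta function on the closed unit disc\<close>

locale axiom_A_semigroup =
  fixes dg :: "'p \<Rightarrow> nat" and c q \<eta> :: real
  assumes arith_semigroup: "arith_semigroup dg" and axiom_A_sharp: "axiom_A_sharp dg c q \<eta>"

sublocale axiom_A_semigroup \<subseteq> graded_primes dg q
  using arith_semigroup axiom_A_sharp
  by unfold_locales (auto simp: arith_semigroup_def axiom_A_sharp_def)

context axiom_A_semigroup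
begin

lemma c_pos: "c > 0"
  using axiom_A_sharp by (simp add: axiom_A_sharp_def)

definition \<rho> :: real where "\<rho> = q powr (\<eta> - 1)"

lemma \<rho>_pos: "\<rho> > 0"
  using q_pos by (simp add: \<rho>_def)

lemma one_less_inverse_\<rho>: "1 < 1 / \<rho>"
  using axiom_A_sharp \<rho>_pos by (simp add: axiom_A_sharp_def \<rho>_def powr_less_one)

lemma q_powr_\<eta>: "q powr (\<eta> * real n) = (\<rho> * q) ^ n"
proof -
  have "\<rho> * q = q powr \<eta>" using q_pos by (simp add: \<rho>_def powr_diff)
  then show ?thesis using q_pos by (simp add: powr_powr flip: powr_realpow)
qed

lemma zeta_fps_UNIV_nth:
  "fps_nth (zeta_fps UNIV) n = of_real (real (card {g::'p multiset. deg g = n}) / q ^ n)"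
  by (simp add: zeta_fps_def gen_fps_nth)

lemma zeta_fps_asymp:
  obtains C where "\<And>n. norm (fps_nth (zeta_fps UNIV) n - of_real c) \<le> C * \<rho> ^ n"
proof -
  let ?err = "\<lambda>n. real (card {g::'p multiset. deg g = n}) - c * q ^ n"
  obtain K where "\<forall>\<^sub>F n in sequentially. norm (?err n) \<le> K * norm (q powr (\<eta> * real n))"
    using axiom_A_sharp by (auto simp: axiom_A_sharp_def elim: landau_o.bigE)
  then have "\<forall>\<^sub>F n in sequentially. norm (?err n / (\<rho> * q) ^ n) \<le> K"
    by eventually_elim (use q_pos \<rho>_pos in \<open>simp add: q_powr_\<eta> norm_divide divide_le_eq\<close>)
  then have "Bseq (\<lambda>n. ?err n / (\<rho> * q) ^ n)" by (rule BfunI)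
  then obtain C where err_le: "\<And>n. norm (?err n / (\<rho> * q) ^ n) \<le> C" unfolding Bseq_def by blast
  show thesis
  proof
    fix n
    have "fps_nth (zeta_fps UNIV) n - complex_of_real c = of_real (?err n / (\<rho> * q) ^ n * \<rho> ^ n)"
      using \<rho>_pos by (simp add: zeta_fps_UNIV_nth power_mult_distrib field_simps)
    also have "norm \<dots> = norm (?err n / (\<rho> * q) ^ n) * \<rho> ^ n"
      using \<rho>_pos unfolding norm_of_real abs_mult by simp
    also have "\<dots> \<le> C * \<rho> ^ n"
      using err_le \<rho>_pos by (intro mult_right_mono) auto
    finally show "norm (fps_nth (zeta_fps UNIV) n - of_real c) \<le> C * \<rho> ^ n" .
  qed
qed

lemma zeta_fps_bounded:
  obtains B where "\<And>A n. norm (fps_nth (zeta_fps A) n) \<le> B"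
proof -
  obtain C where asymp: "\<And>n. norm (fps_nth (zeta_fps UNIV) n - of_real c) \<le> C * \<rho> ^ n"
    using zeta_fps_asymp by blast
  then have "C \<ge> 0" using order.trans[OF norm_ge_zero asymp[of 0]] by simp
  show thesis
  proof
    fix A n
    have "norm (fps_nth (zeta_fps A) n) \<le> norm (fps_nth (zeta_fps UNIV) n)"
      by (rule norm_zeta_fps_nth_mono) simp
    also have "\<dots> \<le> norm (fps_nth (zeta_fps UNIV) n - of_real c) + norm (complex_of_real c)"
      by norm
    also have "norm (fps_nth (zeta_fps UNIV) n - of_real c) \<le> C * 1 ^ n"
      using \<open>C \<ge> 0\<close> \<rho>_pos one_less_inverse_\<rho>
      by (intro order.trans[OF asymp] mult_left_mono power_mono) auto
    finally show "norm (fps_nth (zeta_fps A) n) \<le> C * 1 + norm (complex_of_real c)" by simp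
  qed
qed

lemma fps_conv_radius_zeta_fps_ge: "fps_conv_radius (zeta_fps A) \<ge> 1"
  and fps_conv_radius_moebius_fps_ge: "fps_conv_radius (moebius_fps A) \<ge> 1"
proof -
  obtain B where zeta_le: "\<And>A n. norm (fps_nth (zeta_fps A) n) \<le> B" using zeta_fps_bounded by blast
  then have "norm (fps_nth (moebius_fps A) n) \<le> B" for n
    using norm_moebius_fps_nth_le order.trans by blast
  then show "fps_conv_radius (zeta_fps A) \<ge> 1" "fps_conv_radius (moebius_fps A) \<ge> 1"
    using fps_conv_radius_ge_geometric[of "zeta_fps A" B 1] fps_conv_radius_ge_geometric[of "moebius_fps A" B 1] zeta_le
    by (simp_all add: one_ereal_def)
qed

lemma norm_less_fps_conv_radius:
  assumes "norm (z::complex) < 1"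
  shows "ereal (norm z) < fps_conv_radius (zeta_fps A)" "ereal (norm z) < fps_conv_radius (moebius_fps A)"
  by (rule less_le_trans[OF _ fps_conv_radius_zeta_fps_ge] less_le_trans[OF _ fps_conv_radius_moebius_fps_ge],
      use assms in \<open>simp add: one_ereal_def\<close>)+

lemma eval_zeta_fps_mult_moebius_fps:
  assumes "norm z < 1"
  shows "eval_fps (zeta_fps A) z * eval_fps (moebius_fps A) z = 1"
  using eval_fps_mult[of z "zeta_fps A" "moebius_fps A"] norm_less_fps_conv_radius[OF assms, of A]
  by (simp add: zeta_fps_mult_moebius_fps)

lemma eval_moebius_fps_tendsto:
  assumes z: "norm z < 1"
  shows "(\<lambda>K. eval_fps (moebius_fps {P. dg P \<le> K}) z) \<longlonglongrightarrow> eval_fps (moebius_fps UNIV) z"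
proof -
  obtain B where zeta_le: "\<And>A n. norm (fps_nth (zeta_fps A) n) \<le> B" using zeta_fps_bounded by blast
  show ?thesis
    unfolding eval_fps_def
  proof (rule conjunct2[OF conjunct2[OF tannerys_theorem[where M = "\<lambda>n. B * norm z ^ n"]]])
    fix n
    have "\<forall>\<^sub>F K in sequentially. fps_nth (moebius_fps UNIV) n * z ^ n
        = fps_nth (moebius_fps {P. dg P \<le> K}) n * z ^ n"
      using eventually_ge_at_top[of n]
      by eventually_elim (use gen_fps_free_on_truncate[of n _ _ UNIV] in \<open>simp add: moebius_fps_def\<close>)
    then show "(\<lambda>K. fps_nth (moebius_fps {P. dg P \<le> K}) n * z ^ n) \<longlonglongrightarrow> fps_nth (moebius_fps UNIV) n * z ^ n"
      by (rule Lim_transform_eventually[OF tendsto_const])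
    have "norm (fps_nth (moebius_fps A) n * z ^ n) \<le> B * norm z ^ n" for A n
      using order.trans[OF norm_moebius_fps_nth_le zeta_le]
      by (auto simp: norm_mult norm_power intro!: mult_right_mono)
    then show "\<forall>\<^sub>F (n, K) in sequentially \<times>\<^sub>F sequentially.
        norm (fps_nth (moebius_fps {P. dg P \<le> K}) n * z ^ n) \<le> B * norm z ^ n"
      by (intro always_eventually) auto
    show "summable (\<lambda>n. B * norm z ^ n)"
      using z by (intro summable_mult summable_geometric) simp
  qed simp
qed

lemma prod_zeta_factors:
  "(\<Prod>m\<le>n. inverse ((1 - (z / of_real q) ^ Suc m) ^ card {P. dg P = Suc m}))
    = inverse (eval_fps (moebius_fps {P. dg P \<le> Suc n}) z)"
proof -
  have "P \<in> {P. dg P \<le> Suc n} \<longleftrightarrow> P \<in> (\<Union>m\<le>n. {P. dg P = Suc m})" for P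
    using dg_pos[of P] by (cases "dg P") auto
  then have "{P. dg P \<le> Suc n} = (\<Union>m\<le>n. {P. dg P = Suc m})" by blast
  then have "eval_fps (moebius_fps {P. dg P \<le> Suc n}) z
      = (\<Prod>P\<in>(\<Union>m\<le>n. {P. dg P = Suc m}). 1 - (z / of_real q) ^ dg P)"
    by (metis eval_moebius_fps_finite finite_dg_le)
  also have "\<dots> = (\<Prod>m\<le>n. \<Prod>P\<in>{P. dg P = Suc m}. 1 - (z / of_real q) ^ dg P)"
    by (rule prod.UNION_disjoint) (auto simp: finite_dg)
  also have "\<dots> = (\<Prod>m\<le>n. (1 - (z / of_real q) ^ Suc m) ^ card {P. dg P = Suc m})"
    by (intro prod.cong refl) simp
  finally show ?thesis by (simp add: prod_inversef[unfolded comp_def])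
qed

lemma zetaG_eq_eval_zeta_fps:
  assumes z: "norm z < 1"
  shows "zetaG dg (z / of_real q) = eval_fps (zeta_fps UNIV) z"
proof -
  let ?factor = "\<lambda>m. inverse ((1 - (z / of_real q) ^ Suc m) ^ card {P. dg P = Suc m})"
  have "eval_fps (zeta_fps UNIV) z * eval_fps (moebius_fps UNIV) z = 1"
    using eval_zeta_fps_mult_moebius_fps[OF z] .
  then have nz: "eval_fps (moebius_fps UNIV) z \<noteq> 0"
    and inv: "inverse (eval_fps (moebius_fps UNIV) z) = eval_fps (zeta_fps UNIV) z"
    by (auto intro: inverse_unique simp: mult.commute)
  have "(\<lambda>n. \<Prod>m\<le>n. ?factor m) \<longlonglongrightarrow> inverse (eval_fps (moebius_fps UNIV) z)"
    unfolding prod_zeta_factors by (intro tendsto_inverse LIMSEQ_Suc[OF eval_moebius_fps_tendsto] z nz)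
  then have "?factor has_prod eval_fps (zeta_fps UNIV) z"
    using nz by (simp add: has_prod_def raw_has_prod_def flip: inv)
  then show ?thesis unfolding zetaG_def by (rule has_prod_unique[symmetric])
qed

definition reduced_zeta_fps :: "complex fps" where
  "reduced_zeta_fps = zeta_fps UNIV * (1 - fps_X)"

lemma zeta_fps_UNIV_eq: "zeta_fps UNIV = reduced_zeta_fps / (1 - fps_X)"
  by (simp add: reduced_zeta_fps_def)

lemma inverse_reduced_zeta_fps: "inverse reduced_zeta_fps = moebius_fps UNIV / (1 - fps_X)"
proof (rule fps_inverse_unique)
  have "reduced_zeta_fps * (moebius_fps UNIV / (1 - fps_X))
      = (zeta_fps UNIV * moebius_fps UNIV) * (inverse (1 - fps_X) * (1 - fps_X))"
    by (simp add: reduced_zeta_fps_def fps_divide_unit mult_ac)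
  then show "reduced_zeta_fps * (moebius_fps UNIV / (1 - fps_X)) = 1"
    by (simp add: zeta_fps_mult_moebius_fps inverse_mult_eq_1)
qed

lemma eval_one_minus_fps_X: "eval_fps (1 - fps_X) z = 1 - z"
  and fps_conv_radius_one_minus_fps_X: "fps_conv_radius (1 - fps_X :: complex fps) = \<infinity>"
  for z :: complex
  using fps_conv_radius_diff[of 1 "fps_X :: complex fps"] by (simp_all add: eval_fps_diff)

text \<open>Axiom \<open>A\<^sup>#\<close> says that \<open>Z - c / (1 - X)\<close> converges on a disc of radius \<open>1 / \<rho>\<close>.\<close>

lemma fps_conv_radius_reduced_zeta_fps_ge: "fps_conv_radius reduced_zeta_fps \<ge> 1 / \<rho>"
  and eval_reduced_zeta_fps_1: "eval_fps reduced_zeta_fps 1 = of_real c"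
proof -
  define E where "E = zeta_fps UNIV - fps_const (of_real c) / (1 - fps_X)"
  have "fps_nth E n = fps_nth (zeta_fps UNIV) n - of_real c" for n
    by (simp add: E_def fps_divide_one_minus_X_nth)
  then have E_radius: "fps_conv_radius E \<ge> 1 / \<rho>"
    using fps_conv_radius_ge_geometric[of E] zeta_fps_asymp \<rho>_pos by metis
  have reduced_eq: "reduced_zeta_fps = E * (1 - fps_X) + fps_const (of_real c)"
    by (simp add: E_def reduced_zeta_fps_def left_diff_distrib fps_divide_unit mult.assoc inverse_mult_eq_1)
  have prod_radius: "fps_conv_radius (E * (1 - fps_X)) \<ge> 1 / \<rho>"
    using fps_conv_radius_mult[of E "1 - fps_X"] E_radius by (simp add: fps_conv_radius_one_minus_fps_X)
  then show "fps_conv_radius reduced_zeta_fps \<ge> 1 / \<rho>"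
    using fps_conv_radius_add[of "E * (1 - fps_X)" "fps_const (of_real c)"] by (simp add: reduced_eq)
  have "norm (1::complex) < ereal (1 / \<rho>)" using one_less_inverse_\<rho> by simp
  then show "eval_fps reduced_zeta_fps 1 = of_real c"
    using less_le_trans[OF _ E_radius] less_le_trans[OF _ prod_radius]
    by (simp add: reduced_eq eval_fps_add eval_fps_mult eval_one_minus_fps_X fps_conv_radius_one_minus_fps_X)
qed

lemma norm_less_fps_conv_radius_reduced_zeta_fps:
  "norm (z::complex) < 1 / \<rho> \<Longrightarrow> ereal (norm z) < fps_conv_radius reduced_zeta_fps"
  by (rule less_le_trans[OF _ fps_conv_radius_reduced_zeta_fps_ge]) simp

lemma isCont_eval_reduced_zeta_fps: "norm z < 1 / \<rho> \<Longrightarrow> isCont (eval_fps reduced_zeta_fps) z"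
  using has_field_derivative_eval_fps[OF norm_less_fps_conv_radius_reduced_zeta_fps] DERIV_isCont by blast

lemma eval_reduced_zeta_fps:
  assumes "norm z < 1"
  shows "eval_fps reduced_zeta_fps z = eval_fps (zeta_fps UNIV) z * (1 - z)"
  unfolding reduced_zeta_fps_def using norm_less_fps_conv_radius[OF assms]
  by (simp add: eval_fps_mult eval_one_minus_fps_X fps_conv_radius_one_minus_fps_X)

lemma eval_reduced_zeta_fps_mult_moebius_fps:
  "norm z < 1 \<Longrightarrow> eval_fps reduced_zeta_fps z * eval_fps (moebius_fps UNIV) z = 1 - z"
  using eval_zeta_fps_mult_moebius_fps[of z UNIV] by (simp add: eval_reduced_zeta_fps mult_ac)

lemma three_four_one_moebius_fps_le_1:
  assumes x: "0 \<le> x" "x < 1" and u: "norm u = 1"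
  shows "three_four_one (eval_fps (moebius_fps UNIV)) x u \<le> 1"
proof (rule LIMSEQ_le_const2)
  let ?M = "\<lambda>K. eval_fps (moebius_fps {P. dg P \<le> K})"
  show "(\<lambda>K. three_four_one (?M K) x u) \<longlonglongrightarrow> three_four_one (eval_fps (moebius_fps UNIV)) x u"
    unfolding three_four_one_def using x u
    by (intro tendsto_intros eval_moebius_fps_tendsto) (auto simp: norm_mult norm_power)
  have "three_four_one (?M K) x u \<le> 1" for K
  proof -
    have "three_four_one (\<lambda>z. 1 - (z / of_real q) ^ dg P) x u
        = three_four_one (\<lambda>z. 1 - z) ((x / q) ^ dg P) (u ^ dg P)" for P
      by (simp add: three_four_one_def power_divide power_mult_distrib mult.commute flip: power_mult)
    moreover have "three_four_one (\<lambda>z. 1 - z) ((x / q) ^ dg P) (u ^ dg P) \<le> 1" for P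
    proof (rule three_four_one_one_minus_le_1)
      show "(x / q) ^ dg P < 1"
        using norm_power_dg_less_1[of "of_real x" P] x q_gt_1 by (simp add: norm_power norm_divide)
    qed (use x q_pos u in \<open>auto simp: norm_power\<close>)
    ultimately show ?thesis
      by (simp add: eval_moebius_fps_finite[OF finite_dg_le, abs_def] three_four_one_prod
          three_four_one_nonneg prod_le_1)
  qed
  then show "\<exists>N. \<forall>K\<ge>N. three_four_one (?M K) x u \<le> 1" by blast
qed

lemma three_four_one_reduced_zeta_fps_ge:
  assumes x: "0 \<le> x" "x < 1" and u: "norm u = 1"
  shows "three_four_one (\<lambda>z. 1 - z) x u \<le> three_four_one (eval_fps reduced_zeta_fps) x u"
proof -
  let ?H = "eval_fps reduced_zeta_fps" and ?M = "eval_fps (moebius_fps UNIV)"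
  have "three_four_one (\<lambda>z. 1 - z) x u = three_four_one (\<lambda>z. ?H z * ?M z) x u"
    unfolding three_four_one_def using x u
    by (subst (1 2 3) eval_reduced_zeta_fps_mult_moebius_fps) (auto simp: norm_mult norm_power)
  also have "\<dots> = three_four_one ?H x u * three_four_one ?M x u"
    by (rule three_four_one_mult)
  also have "\<dots> \<le> three_four_one ?H x u * 1"
    by (intro mult_left_mono three_four_one_moebius_fps_le_1 three_four_one_nonneg x u)
  finally show ?thesis by simp
qed

lemma reduced_zeta_nonzero_on_circle:
  assumes u: "norm u = 1" "u \<noteq> 1" "u \<noteq> -1"
  shows "eval_fps reduced_zeta_fps u \<noteq> 0"
proof (rule nonzero_if_three_four_one_ge[where F = "eval_fps reduced_zeta_fps"])
  show "(eval_fps reduced_zeta_fps has_field_derivative eval_fps (fps_deriv reduced_zeta_fps) u) (at u)"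
    using u one_less_inverse_\<rho> by (intro has_field_derivative_eval_fps norm_less_fps_conv_radius_reduced_zeta_fps) simp
  show "isCont (eval_fps reduced_zeta_fps) 1" "isCont (eval_fps reduced_zeta_fps) (u\<^sup>2)"
    using u one_less_inverse_\<rho> by (auto intro!: isCont_eval_reduced_zeta_fps simp: norm_power)
qed (use u three_four_one_reduced_zeta_fps_ge in auto)

lemma reduced_zeta_minus_one_nonzero:
  assumes "zeta_nonzero_at_minus dg q \<eta>"
  shows "eval_fps reduced_zeta_fps (-1) \<noteq> 0"
proof -
  let ?D = "ball (0::complex) (q powr (-\<eta>)) - {of_real (1 / q)}"
  obtain F where F: "F holomorphic_on ?D" "\<And>z. z \<in> ball 0 (1 / q) \<Longrightarrow> F z = zetaG dg z"
      "F (of_real (- (1 / q))) \<noteq> 0"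
    using assms by (auto simp: zeta_nonzero_at_minus_def)
  have radius: "q powr (-\<eta>) = 1 / \<rho> / q"
    using q_pos by (simp add: \<rho>_def powr_diff powr_minus field_simps)
  have "1 / q < q powr (-\<eta>)"
    unfolding radius using one_less_inverse_\<rho> q_pos by (rule divide_strict_right_mono)
  have "eval_fps reduced_zeta_fps (of_real q * of_real (- (1 / q)))
      = F (of_real (- (1 / q))) * (1 - of_real q * of_real (- (1 / q)))"
  proof (rule analytic_continuation_open[where s = "ball 0 (1 / q)" and s' = ?D
        and f = "\<lambda>z. eval_fps reduced_zeta_fps (of_real q * z)" and g = "\<lambda>z. F z * (1 - of_real q * z)"])
    show "connected ?D"
      by (intro connected_open_delete) auto
    have "norm (of_real q * z) < 1 / \<rho>" if "z \<in> ?D" for z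
    proof -
      have "norm z < 1 / \<rho> / q" using that by (simp add: radius)
      then have "norm z * q < 1 / \<rho>" by (simp only: pos_less_divide_eq[OF q_pos])
      then show ?thesis using q_pos by (simp add: norm_mult mult.commute)
    qed
    then have "eval_fps reduced_zeta_fps \<circ> (\<lambda>z. of_real q * z) holomorphic_on ?D"
      by (intro holomorphic_on_compose holomorphic_intros) (auto intro!: norm_less_fps_conv_radius_reduced_zeta_fps)
    then show "(\<lambda>z. eval_fps reduced_zeta_fps (of_real q * z)) holomorphic_on ?D"
      by (simp add: o_def)
    show "(\<lambda>z. F z * (1 - of_real q * z)) holomorphic_on ?D"
      by (intro holomorphic_intros F(1))
    show "eval_fps reduced_zeta_fps (of_real q * z) = F z * (1 - of_real q * z)" if "z \<in> ball 0 (1 / q)" for z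
    proof -
      have "norm (of_real q * z) < 1" using that q_pos by (simp add: norm_mult field_simps)
      then show ?thesis
        using zetaG_eq_eval_zeta_fps[of "of_real q * z"] by (simp add: eval_reduced_zeta_fps F(2)[OF that])
    qed
  qed (use q_pos \<open>1 / q < q powr (-\<eta>)\<close> in \<open>auto simp: norm_divide\<close>)
  then show ?thesis using F(3) by simp
qed

end

locale axiom_A_zeta_nonzero_semigroup = axiom_A_semigroup +
  assumes zeta_nonzero_at_minus: "zeta_nonzero_at_minus dg q \<eta>"
begin

lemma reduced_zeta_nonzero_cball:
  assumes "norm z \<le> 1"
  shows "eval_fps reduced_zeta_fps z \<noteq> 0"
proof (cases "norm z < 1")
  case True
  then have "1 - z \<noteq> 0" by auto
  then show ?thesis using eval_reduced_zeta_fps_mult_moebius_fps[OF True] by auto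
next
  case False
  then have "norm z = 1" using assms by simp
  then show ?thesis
    using reduced_zeta_nonzero_on_circle[of z] reduced_zeta_minus_one_nonzero[OF zeta_nonzero_at_minus]
      eval_reduced_zeta_fps_1 c_pos by fastforce
qed

lemma reduced_zeta_fps_summable: "summable (\<lambda>n. norm (fps_nth reduced_zeta_fps n))"
  and reduced_zeta_fps_suminf: "suminf (fps_nth reduced_zeta_fps) = of_real c"
proof -
  have "norm (1::complex) < fps_conv_radius reduced_zeta_fps"
    by (rule norm_less_fps_conv_radius_reduced_zeta_fps) (use one_less_inverse_\<rho> in simp)
  from norm_summable_fps[OF this] show "summable (\<lambda>n. norm (fps_nth reduced_zeta_fps n))" by simp
  show "suminf (fps_nth reduced_zeta_fps) = of_real c"
    using eval_reduced_zeta_fps_1 by (simp add: eval_fps_def)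
qed

lemma inverse_reduced_zeta_fps_summable: "summable (\<lambda>n. norm (fps_nth (inverse reduced_zeta_fps) n))"
  and inverse_reduced_zeta_fps_suminf: "suminf (fps_nth (inverse reduced_zeta_fps)) = 1 / of_real c"
proof -
  have "continuous_on (ball 0 (1 / \<rho>)) (eval_fps reduced_zeta_fps)"
    by (rule continuous_on_subset[OF continuous_on_eval_fps]) (auto intro!: norm_less_fps_conv_radius_reduced_zeta_fps)
  then obtain r where r: "r > 1" "\<And>z. norm z < r \<Longrightarrow> eval_fps reduced_zeta_fps z \<noteq> 0"
    using continuous_nonzero_beyond_cball[OF _ one_less_inverse_\<rho>, of "eval_fps reduced_zeta_fps"]
      reduced_zeta_nonzero_cball by metis
  have one_in_radius: "norm (1::complex) < min (ereal r) (fps_conv_radius reduced_zeta_fps)"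
    using r(1) norm_less_fps_conv_radius_reduced_zeta_fps[of 1] one_less_inverse_\<rho> by simp
  also have "\<dots> \<le> fps_conv_radius (inverse reduced_zeta_fps)"
    by (rule fps_conv_radius_inverse) (use r in auto)
  finally show "summable (\<lambda>n. norm (fps_nth (inverse reduced_zeta_fps) n))"
    using norm_summable_fps[of "1::complex" "inverse reduced_zeta_fps"] by simp
  have "eval_fps (inverse reduced_zeta_fps) 1 = inverse (eval_fps reduced_zeta_fps 1)"
    by (rule eval_fps_inverse[of r]) (use r one_in_radius in auto)
  then show "suminf (fps_nth (inverse reduced_zeta_fps)) = 1 / of_real c"
    unfolding eval_reduced_zeta_fps_1 by (simp add: eval_fps_def divide_inverse)
qed

lemma moebius_fps_Compl_partial_sum_eq:
  "moebius_fps (- A) / (1 - fps_X) = inverse reduced_zeta_fps * zeta_fps A"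
  by (simp add: moebius_fps_Compl inverse_reduced_zeta_fps fps_divide_unit mult_ac)

lemma moebius_fps_partial_sums_bounded:
  obtains B where "\<And>A n. norm (fps_nth (moebius_fps A / (1 - fps_X)) n) \<le> B"
proof -
  obtain B where zeta_le: "\<And>A n. norm (fps_nth (zeta_fps A) n) \<le> B" using zeta_fps_bounded by blast
  have "norm (fps_nth (moebius_fps A / (1 - fps_X)) n) \<le> (\<Sum>n. norm (fps_nth (inverse reduced_zeta_fps) n)) * B" for A n
    using moebius_fps_Compl_partial_sum_eq[of "- A"]
    by (simp add: norm_fps_mult_nth_le inverse_reduced_zeta_fps_summable zeta_le)
  then show thesis using that by blast
qed

lemma moebius_fps_Compl_partial_sums_tendsto_0:
  assumes "finite A"
  shows "fps_nth (moebius_fps (- A) / (1 - fps_X)) \<longlonglongrightarrow> 0"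
  using fps_mult_nth_tendsto[OF inverse_reduced_zeta_fps_summable zeta_fps_finite_tendsto_0[OF assms]]
  by (simp add: moebius_fps_Compl_partial_sum_eq)

end

subsection \<open>A Mertens-type bound\<close>

context axiom_A_semigroup
begin

lemma exp_sum_prime_powers_le_norm_zeta_fps:
  assumes "finite A" and x: "0 \<le> x" "x < q"
  shows "exp (\<Sum>P\<in>A. (x / q) ^ dg P) \<le> norm (eval_fps (zeta_fps A) (of_real x))"
proof -
  have less_1: "(x / q) ^ dg P < 1" for P
    using norm_power_dg_less_1[of "of_real x" P] x q_pos by (simp add: norm_power norm_divide)
  have exp_le: "exp y \<le> 1 / (1 - y)" if "y < 1" for y :: real
    using exp_ge_add_one_self[of "- y"] that by (simp add: exp_minus field_simps)
  have "exp (\<Sum>P\<in>A. (x / q) ^ dg P) = (\<Prod>P\<in>A. exp ((x / q) ^ dg P))"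
    using assms(1) by (rule exp_sum)
  also have "\<dots> \<le> (\<Prod>P\<in>A. 1 / (1 - (x / q) ^ dg P))"
    by (intro prod_mono conjI exp_le less_1) simp
  also have "\<dots> \<le> norm (complex_of_real (\<Prod>P\<in>A. 1 / (1 - (x / q) ^ dg P)))"
    unfolding norm_of_real by simp
  also have "complex_of_real (\<Prod>P\<in>A. 1 / (1 - (x / q) ^ dg P)) = eval_fps (zeta_fps A) (of_real x)"
    using x assms(1) by (simp add: eval_zeta_fps_finite)
  finally show ?thesis .
qed

lemma sum_prime_powers_le_ln:
  assumes "finite A" and x: "0 \<le> x" "x < 1" and zeta_le: "\<And>n. norm (fps_nth (zeta_fps A) n) \<le> B"
  shows "(\<Sum>P\<in>A. (x / q) ^ dg P) \<le> ln (B / (1 - x))"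
proof -
  have "exp (\<Sum>P\<in>A. (x / q) ^ dg P) \<le> norm (eval_fps (zeta_fps A) (of_real x))"
    using x q_gt_1 by (intro exp_sum_prime_powers_le_norm_zeta_fps \<open>finite A\<close>) auto
  also have "\<dots> \<le> (\<Sum>n. B * x ^ n)"
    unfolding eval_fps_def using x zeta_le
    by (intro norm_suminf_le summable_mult summable_geometric)
      (auto simp: norm_mult norm_power intro!: mult_right_mono)
  also have "\<dots> = B / (1 - x)"
    using x by (simp add: suminf_mult suminf_geometric summable_geometric)
  finally show ?thesis
    using less_le_trans[OF exp_gt_zero] by (subst ln_ge_iff)
qed

text \<open>At \<open>x = 1 - 1 / (2 * d)\<close> the bound \<open>B / (1 - x)\<close> is linear in \<open>d\<close>, while \<open>x ^ d \<ge> 1 / 2\<close>.\<close>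

lemma sum_inverse_primes_le_ln:
  obtains K where "K \<ge> 0" "\<And>d. d \<ge> 1 \<Longrightarrow> (\<Sum>P\<in>{P. dg P \<le> d}. 1 / q ^ dg P) \<le> K * (1 + ln (real d))"
proof -
  obtain B where zeta_le: "\<And>A n. norm (fps_nth (zeta_fps A) n) \<le> B" using zeta_fps_bounded by blast
  have "B \<ge> 1" using zeta_le[of "{}" 0] by simp
  show thesis
  proof
    show "0 \<le> 2 * (1 + ln (2 * B))" using \<open>B \<ge> 1\<close> by simp
    fix d :: nat assume d: "d \<ge> 1"
    define x where "x = 1 - 1 / (2 * real d)"
    let ?A = "{P. dg P \<le> d}"
    have x: "0 \<le> x" "x < 1" using d by (auto simp: x_def field_simps)
    have "1 + real d * (- 1 / (2 * real d)) \<le> (1 + - 1 / (2 * real d)) ^ d"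
      using d by (intro Bernoulli_inequality) (auto simp: field_simps)
    then have x_pow_d: "1 / 2 \<le> x ^ d" using d by (simp add: x_def)
    have "(\<Sum>P\<in>?A. (x / q) ^ dg P) \<le> ln (B / (1 - x))"
      by (intro sum_prime_powers_le_ln finite_dg_le x zeta_le)
    also have "\<dots> = ln (2 * B) + ln (real d)"
      using \<open>B \<ge> 1\<close> d ln_mult_pos[of "2 * B" "real d"] by (simp add: x_def mult_ac)
    finally have sum_le: "(\<Sum>P\<in>?A. (x / q) ^ dg P) \<le> ln (2 * B) + ln (real d)" .
    have "(\<Sum>P\<in>?A. 1 / q ^ dg P) \<le> (\<Sum>P\<in>?A. 2 * (x / q) ^ dg P)"
    proof (rule sum_mono)
      fix P assume "P \<in> ?A"
      then have "x ^ d \<le> x ^ dg P" using x by (intro power_decreasing) auto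
      then have "1 \<le> 2 * x ^ dg P" using x_pow_d by simp
      then show "1 / q ^ dg P \<le> 2 * (x / q) ^ dg P"
        using q_pos by (simp add: power_divide divide_right_mono)
    qed
    also have "\<dots> \<le> 2 * (ln (2 * B) + ln (real d))"
      using sum_le by (simp flip: sum_distrib_left)
    also have "\<dots> \<le> 2 * (1 + ln (2 * B)) * (1 + ln (real d))"
    proof -
      have "0 \<le> ln (2 * B) * ln (real d)" using \<open>B \<ge> 1\<close> d by simp
      then show ?thesis by (simp add: algebra_simps)
    qed
    finally show "(\<Sum>P\<in>?A. 1 / q ^ dg P) \<le> 2 * (1 + ln (2 * B)) * (1 + ln (real d))" .
  qed
qed

end

subsection \<open>Sorting by extremal primes\<close>

definition is_min_prime :: "('p \<Rightarrow> nat) \<Rightarrow> 'p \<Rightarrow> 'p multiset \<Rightarrow> bool" where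
  "is_min_prime dg Q g \<longleftrightarrow> Q \<in># g \<and> (\<forall>P\<in>#g. P \<noteq> Q \<longrightarrow> dg Q < dg P)"

lemma is_min_prime_unique: "is_min_prime dg Q g \<Longrightarrow> is_min_prime dg Q' g \<Longrightarrow> Q = Q'"
  unfolding is_min_prime_def by (metis less_asym)

lemma d_minus_eq_dg_min_prime: "is_min_prime dg Q g \<Longrightarrow> d_minus dg g = dg Q"
  unfolding d_minus_def is_min_prime_def by (intro Min_eqI) (auto intro: less_imp_le)

lemma distinguishable_iff_min_prime: "distinguishable dg g \<longleftrightarrow> (\<exists>Q. is_min_prime dg Q g)"
proof
  assume "distinguishable dg g"
  then obtain Q where Q: "Q \<in># g" "dg Q = d_minus dg g" "\<And>P. P \<in># g \<Longrightarrow> dg P = d_minus dg g \<Longrightarrow> P = Q"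
    unfolding distinguishable_def by blast
  have "d_minus dg g \<le> dg P" if "P \<in># g" for P
    unfolding d_minus_def using that by (intro Min_le) auto
  then show "\<exists>Q. is_min_prime dg Q g"
    using Q unfolding is_min_prime_def by (metis le_neq_implies_less)
next
  assume "\<exists>Q. is_min_prime dg Q g"
  then obtain Q where Q: "is_min_prime dg Q g" by blast
  then show "distinguishable dg g"
    using d_minus_eq_dg_min_prime[OF Q] unfolding distinguishable_def is_min_prime_def
    by (metis less_irrefl set_mset_empty empty_iff)
qed

lemma P_min_eq:
  assumes "is_min_prime dg Q g"
  shows "P_min dg g = Q"
  unfolding P_min_def d_minus_eq_dg_min_prime[OF assms]
  using assms by (intro the_equality) (auto simp: is_min_prime_def)

lemma Dset_minus_empty_eq: "Dset dg S - {{#}} = (\<Union>Q\<in>S. {g. is_min_prime dg Q g})"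
proof -
  have "g \<noteq> {#}" if "is_min_prime dg Q g" for Q g
    using that by (auto simp: is_min_prime_def)
  then show ?thesis
    by (auto simp: Dset_def distinguishable_iff_min_prime P_min_eq)
qed

lemma is_min_prime_add_iff:
  assumes "is_min_prime dg Q\<^sub>0 h"
  shows "is_min_prime dg Q (h + r) \<longleftrightarrow>
    Q = Q\<^sub>0 \<and> r \<in> free_on (- ({P. dg P \<le> dg Q\<^sub>0} - {Q\<^sub>0})) \<or> dg Q < dg Q\<^sub>0 \<and> is_min_prime dg Q r"
proof -
  have Q\<^sub>0: "Q\<^sub>0 \<in># h" using assms by (simp add: is_min_prime_def)
  have dg_ge: "dg Q\<^sub>0 \<le> dg P" "P \<noteq> Q\<^sub>0 \<Longrightarrow> dg Q\<^sub>0 < dg P" if "P \<in># h" for P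
    using assms that by (auto simp: is_min_prime_def intro: less_imp_le)
  consider "Q = Q\<^sub>0" | "Q \<noteq> Q\<^sub>0" "dg Q < dg Q\<^sub>0" | "Q \<noteq> Q\<^sub>0" "dg Q\<^sub>0 \<le> dg Q"
    by linarith
  then show ?thesis
  proof cases
    case 1
    then show ?thesis
      using Q\<^sub>0 dg_ge(2) by (auto simp: is_min_prime_def free_on_def not_le)
  next
    case 2
    then have "Q \<notin># h" "\<And>P. P \<in># h \<Longrightarrow> dg Q < dg P"
      using dg_ge(1) by fastforce+
    then show ?thesis using 2 by (auto simp: is_min_prime_def)
  next
    case 3
    then show ?thesis using Q\<^sub>0 by (auto simp: is_min_prime_def)
  qed
qed

lemma disjoint_family_min_prime: "disjoint_family_on (\<lambda>Q. {g. is_min_prime dg Q (h + g)}) I"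
  by (auto simp: disjoint_family_on_def dest: is_min_prime_unique)

context graded_primes
begin

lemma Dset_deg_between_eq:
  "{g. 1 \<le> deg g \<and> deg g \<le> n \<and> g \<in> Dset dg S} = {g \<in> Dset dg S - {{#}}. deg g \<le> n}"
  by (auto simp: Suc_le_eq simp flip: neq0_conv)

definition min_prime_fps :: "'p \<Rightarrow> complex fps" where
  "min_prime_fps Q = gen_fps (\<lambda>g. of_int (mu_G g)) {g. is_min_prime dg Q g}"

lemma min_prime_fps_eq: "min_prime_fps Q = - (prime_fps Q * moebius_fps (- {P. dg P \<le> dg Q}))"
proof -
  let ?coprime = "free_on (- {P. dg P \<le> dg Q})"
  have notin: "Q \<notin># r" if "r \<in> ?coprime" for r
    using that by (auto simp: free_on_def)
  have "min_prime_fps Q = gen_fps (\<lambda>g. of_int (mu_G g)) (add_mset Q ` ?coprime)"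
    unfolding min_prime_fps_def
  proof (rule gen_fps_cong)
    fix g assume g: "g \<in> {g. is_min_prime dg Q g}"
    then obtain r where r: "g = add_mset Q r" by (auto simp: is_min_prime_def dest: multi_member_split)
    show "g \<in> add_mset Q ` ?coprime \<or> complex_of_int (mu_G g) = 0"
    proof (cases "Q \<in># r")
      case False
      then have "r \<in> ?coprime" using g by (fastforce simp: r is_min_prime_def free_on_def not_le)
      then show ?thesis by (simp add: r)
    qed (simp add: r mu_G_add_mset_eq_0)
  qed (auto simp: is_min_prime_def free_on_def not_le)
  also have "\<dots> = prime_fps Q * gen_fps (\<lambda>r. - 1 * of_int (mu_G r)) ?coprime"
    by (rule gen_fps_add_mset) (simp add: mu_G_add_mset notin)
  finally show ?thesis
    by (simp only: gen_fps_cmult moebius_fps_def) (simp flip: fps_const_neg)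
qed

lemma gen_fps_min_prime:
  assumes "\<And>g. is_min_prime dg Q g \<Longrightarrow> w g = of_int (mu_G g) * k"
  shows "gen_fps w {g. is_min_prime dg Q g} = fps_const k * min_prime_fps Q"
  unfolding min_prime_fps_def gen_fps_cmult[symmetric]
  by (rule gen_fps_cong) (auto simp: assms)

lemma gen_fps_max_prime:
  "gen_fps (\<lambda>_. 1) {g. Q \<in># g \<and> dg Q = d_plus dg g} = prime_fps Q * zeta_fps {P. dg P \<le> dg Q}"
proof -
  have "{g. Q \<in># g \<and> dg Q = d_plus dg g} = add_mset Q ` free_on {P. dg P \<le> dg Q}"
  proof (intro equalityI subsetI)
    fix g assume "g \<in> {g. Q \<in># g \<and> dg Q = d_plus dg g}"
    then have g: "Q \<in># g" "dg Q = Max (dg ` set_mset g)"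
      by (auto simp: d_plus_def split: if_splits)
    then have "\<forall>P\<in>#g. dg P \<le> dg Q" by simp
    then have "g - {#Q#} \<in> free_on {P. dg P \<le> dg Q}" by (auto simp: free_on_def dest: in_diffD)
    then show "g \<in> add_mset Q ` free_on {P. dg P \<le> dg Q}" using g(1) by (metis image_eqI insert_DiffM)
  next
    fix g assume "g \<in> add_mset Q ` free_on {P. dg P \<le> dg Q}"
    then obtain r where r: "g = add_mset Q r" "\<forall>P\<in>#r. dg P \<le> dg Q" by (auto simp: free_on_def)
    then have "Max (dg ` set_mset g) = dg Q" by (intro Max_eqI) auto
    then show "g \<in> {g. Q \<in># g \<and> dg Q = d_plus dg g}" using r(1) by (simp add: d_plus_def)
  qed
  then show ?thesis by (simp add: gen_fps_add_mset zeta_fps_def)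
qed

lemma zeta_fps_mult_min_prime_fps:
  "zeta_fps UNIV * min_prime_fps Q = - (prime_fps Q * zeta_fps {P. dg P \<le> dg Q})"
  by (simp add: min_prime_fps_eq zeta_fps_eq_zeta_UNIV_mult[of "{P. dg P \<le> dg Q}"] mult_ac)

text \<open>\<open>cofactor_fps S f {#}\<close> generates the sums in (ii); the other \<open>h\<close> occur in the expansion of \<open>\<mu> * a\<close>.\<close>

definition cofactor_fps :: "'p set \<Rightarrow> (nat \<Rightarrow> complex) \<Rightarrow> 'p multiset \<Rightarrow> complex fps" where
  "cofactor_fps S f h =
    gen_fps (\<lambda>r. of_int (mu_G r) * f (d_minus dg (h + r))) {r. h + r \<in> Dset dg S - {{#}}}"

lemma cofactor_fps_empty:
  "cofactor_fps S f {#} = gen_fps (\<lambda>g. of_int (mu_G g) * f (d_minus dg g)) (Dset dg S - {{#}})"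
  by (simp only: cofactor_fps_def add_0 Collect_mem_eq)

lemma cofactor_fps_empty_nth:
  assumes "n \<le> N"
  shows "fps_nth (cofactor_fps S f {#}) n =
    fps_nth (\<Sum>Q\<in>{Q \<in> S. dg Q \<le> N}. fps_const (f (dg Q)) * min_prime_fps Q) n"
proof -
  let ?w = "\<lambda>g. of_int (mu_G g) * f (d_minus dg g)"
  have "fps_nth (cofactor_fps S f {#}) n = fps_nth (gen_fps ?w (\<Union>Q\<in>S. {g. is_min_prime dg Q g})) n"
    by (simp only: cofactor_fps_empty Dset_minus_empty_eq)
  also have "\<dots> = (\<Sum>Q\<in>{Q \<in> S. dg Q \<le> N}. fps_nth (gen_fps ?w {g. is_min_prime dg Q g}) n)"
  proof (rule gen_fps_UN_nth)
    fix Q g assume "Q \<in> S" "g \<in> {g. is_min_prime dg Q g}" "deg g = n"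
    then show "Q \<in> {Q \<in> S. dg Q \<le> N}"
      using dg_le_deg[of Q g] assms by (auto simp: is_min_prime_def)
  qed (use disjoint_family_min_prime[of dg "{#}"] in \<open>auto simp: finite_dg_le_on\<close>)
  also have "\<dots> = (\<Sum>Q\<in>{Q \<in> S. dg Q \<le> N}. fps_nth (fps_const (f (dg Q)) * min_prime_fps Q) n)"
    by (intro sum.cong refl arg_cong[where f = "\<lambda>F. fps_nth F n"] gen_fps_min_prime)
      (simp add: d_minus_eq_dg_min_prime)
  finally show ?thesis by (simp add: fps_sum_nth)
qed

lemma cofactor_fps_eq:
  assumes "Q\<^sub>0 \<in> S" and min: "is_min_prime dg Q\<^sub>0 h"
  shows "cofactor_fps S f h = fps_const (f (dg Q\<^sub>0)) * moebius_fps (- ({P. dg P \<le> dg Q\<^sub>0} - {Q\<^sub>0})) +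
    (\<Sum>Q\<in>{Q \<in> S. dg Q < dg Q\<^sub>0}. fps_const (f (dg Q)) * min_prime_fps Q)"
proof -
  let ?w = "\<lambda>r. of_int (mu_G r) * f (d_minus dg (h + r))"
  let ?same = "free_on (- ({P. dg P \<le> dg Q\<^sub>0} - {Q\<^sub>0}))"
    and ?smaller = "\<Union>Q\<in>{Q \<in> S. dg Q < dg Q\<^sub>0}. {r. is_min_prime dg Q r}"
  have finite: "finite {Q \<in> S. dg Q < dg Q\<^sub>0}"
    by (rule finite_subset[OF _ finite_dg_le[of "dg Q\<^sub>0"]]) auto
  have "h + r \<in> Dset dg S - {{#}} \<longleftrightarrow> r \<in> ?same \<union> ?smaller" for r
    using \<open>Q\<^sub>0 \<in> S\<close> by (auto simp: Dset_minus_empty_eq is_min_prime_add_iff[OF min])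
  then have "cofactor_fps S f h = gen_fps ?w (?same \<union> ?smaller)"
    by (simp only: cofactor_fps_def Collect_mem_eq)
  also have "\<dots> = gen_fps ?w ?same + gen_fps ?w ?smaller"
  proof (rule gen_fps_Un)
    have "\<not> is_min_prime dg Q r" if "r \<in> ?same" "dg Q < dg Q\<^sub>0" for Q r
      using that by (auto simp: free_on_def is_min_prime_def)
    then show "?same \<inter> ?smaller = {}" by auto
  qed
  also have "gen_fps ?w ?same = gen_fps (\<lambda>r. f (dg Q\<^sub>0) * of_int (mu_G r)) ?same"
    by (rule gen_fps_cong)
      (auto simp: is_min_prime_add_iff[OF min] d_minus_eq_dg_min_prime[of dg Q\<^sub>0])
  also have "\<dots> = fps_const (f (dg Q\<^sub>0)) * moebius_fps (- ({P. dg P \<le> dg Q\<^sub>0} - {Q\<^sub>0}))"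
    unfolding moebius_fps_def by (rule gen_fps_cmult)
  also have "gen_fps ?w ?smaller = (\<Sum>Q\<in>{Q \<in> S. dg Q < dg Q\<^sub>0}. gen_fps ?w {r. is_min_prime dg Q r})"
    using finite disjoint_family_min_prime[of dg "{#}"] by (intro gen_fps_UN) simp_all
  also have "\<dots> = (\<Sum>Q\<in>{Q \<in> S. dg Q < dg Q\<^sub>0}. fps_const (f (dg Q)) * min_prime_fps Q)"
  proof (intro sum.cong refl gen_fps_min_prime)
    fix Q r assume "Q \<in> {Q \<in> S. dg Q < dg Q\<^sub>0}" "is_min_prime dg Q r"
    then have "is_min_prime dg Q (h + r)" by (simp add: is_min_prime_add_iff[OF min])
    then show "?w r = of_int (mu_G r) * f (dg Q)" by (simp add: d_minus_eq_dg_min_prime)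
  qed
  finally show ?thesis .
qed

definition max_prime_fps :: "'p set \<Rightarrow> (nat \<Rightarrow> complex) \<Rightarrow> complex fps" where
  "max_prime_fps S f = gen_fps (\<lambda>g. of_nat (Q_S dg S g) * f (d_plus dg g)) UNIV"

lemma max_prime_sum_asymp_iff:
  "(\<lambda>n. (\<Sum>g\<in>{g. deg g = n}. of_nat (Q_S dg S g) * f (d_plus dg g)) - complex_of_real (l * q ^ n))
      \<in> o(\<lambda>n. complex_of_real (q ^ n)) \<longleftrightarrow> fps_nth (max_prime_fps S f) \<longlonglongrightarrow> of_real l"
  using smallo_diff_iff_quotient_tendsto[of "\<lambda>n. complex_of_real (q ^ n)"
      "\<lambda>n. \<Sum>g\<in>{g. deg g = n}. of_nat (Q_S dg S g) * f (d_plus dg g)" "of_real l"]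
  by (simp add: max_prime_fps_def gen_fps_def Abs_fps_inverse)

lemma max_prime_fps_nth:
  "fps_nth (max_prime_fps S f) n =
    fps_nth (\<Sum>Q\<in>{Q \<in> S. dg Q \<le> n}. fps_const (f (dg Q)) * (prime_fps Q * zeta_fps {P. dg P \<le> dg Q})) n"
proof -
  let ?U = "{Q \<in> S. dg Q \<le> n}"
  have "(\<Sum>g\<in>{g. deg g = n}. of_nat (Q_S dg S g) * f (d_plus dg g))
      = (\<Sum>g\<in>{g. deg g = n}. \<Sum>Q\<in>{Q \<in> ?U. Q \<in># g \<and> dg Q = d_plus dg g}. f (dg Q))"
  proof (rule sum.cong)
    fix g assume "g \<in> {g. deg g = n}"
    then have "{P \<in> S. P \<in># g \<and> dg P = d_plus dg g} = {Q \<in> ?U. Q \<in># g \<and> dg Q = d_plus dg g}"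
      using dg_le_deg[of _ g] by auto
    then show "of_nat (Q_S dg S g) * f (d_plus dg g) = (\<Sum>Q\<in>{Q \<in> ?U. Q \<in># g \<and> dg Q = d_plus dg g}. f (dg Q))"
      by (simp add: Q_S_def)
  qed simp
  also have "\<dots> = (\<Sum>Q\<in>?U. \<Sum>g\<in>{g \<in> {g. deg g = n}. Q \<in># g \<and> dg Q = d_plus dg g}. f (dg Q))"
    using finite_deg_eq_restrict[of "\<lambda>_. True" n] by (intro sum.swap_restrict) (simp_all add: finite_dg_le_on)
  also have "\<dots> / of_real q ^ n = (\<Sum>Q\<in>?U. f (dg Q) * fps_nth (gen_fps (\<lambda>_. 1) {g. Q \<in># g \<and> dg Q = d_plus dg g}) n)"
    unfolding gen_fps_nth sum_constant by (simp add: sum_divide_distrib mult_ac conj_ac)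
  finally show ?thesis
    by (simp add: max_prime_fps_def gen_fps_nth[of _ UNIV] fps_sum_nth gen_fps_max_prime)
qed

lemma max_prime_fps_eq: "max_prime_fps S f = - (zeta_fps UNIV * cofactor_fps S f {#})"
proof (rule fps_ext)
  fix n
  let ?B = "\<Sum>Q\<in>{Q \<in> S. dg Q \<le> n}. fps_const (f (dg Q)) * min_prime_fps Q"
  have "zeta_fps UNIV * ?B
      = - (\<Sum>Q\<in>{Q \<in> S. dg Q \<le> n}. fps_const (f (dg Q)) * (prime_fps Q * zeta_fps {P. dg P \<le> dg Q}))"
    by (simp add: sum_distrib_left mult.left_commute[of "zeta_fps UNIV"] zeta_fps_mult_min_prime_fps sum_negf)
  then have "fps_nth (max_prime_fps S f) n = - fps_nth (zeta_fps UNIV * ?B) n"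
    by (simp add: max_prime_fps_nth)
  also have "fps_nth (zeta_fps UNIV * ?B) n = fps_nth (zeta_fps UNIV * cofactor_fps S f {#}) n"
    unfolding fps_mult_nth by (intro sum.cong refl) (simp add: cofactor_fps_empty_nth[where N = n])
  finally show "fps_nth (max_prime_fps S f) n = fps_nth (- (zeta_fps UNIV * cofactor_fps S f {#})) n"
    by simp
qed

end

context axiom_A_zeta_nonzero_semigroup
begin

lemma max_prime_fps_tendsto_iff:
  "fps_nth (max_prime_fps S f) \<longlonglongrightarrow> of_real (c * \<delta>) \<longleftrightarrow>
    fps_nth (cofactor_fps S f {#} / (1 - fps_X)) \<longlonglongrightarrow> - of_real \<delta>" (is "?max \<longleftrightarrow> ?min")
proof
  have max_eq: "max_prime_fps S f = reduced_zeta_fps * - (cofactor_fps S f {#} / (1 - fps_X))"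
    by (simp add: max_prime_fps_eq zeta_fps_UNIV_eq fps_divide_unit mult_ac)
  have min_eq: "cofactor_fps S f {#} / (1 - fps_X) = inverse reduced_zeta_fps * - max_prime_fps S f"
  proof -
    have "inverse reduced_zeta_fps * - max_prime_fps S f
        = (zeta_fps UNIV * moebius_fps UNIV) * (cofactor_fps S f {#} / (1 - fps_X))"
      by (simp add: max_prime_fps_eq inverse_reduced_zeta_fps fps_divide_unit mult_ac)
    then show ?thesis by (simp add: zeta_fps_mult_moebius_fps)
  qed
  show ?min if ?max
  proof -
    have "fps_nth (- max_prime_fps S f) \<longlonglongrightarrow> - of_real (c * \<delta>)"
      using fps_uminus_nth_tendsto[OF that] by simp
    from fps_mult_nth_tendsto[OF inverse_reduced_zeta_fps_summable this]
    show ?min using c_pos by (simp add: min_eq inverse_reduced_zeta_fps_suminf)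
  qed
  show ?max if ?min
  proof -
    have "fps_nth (- (cofactor_fps S f {#} / (1 - fps_X))) \<longlonglongrightarrow> of_real \<delta>"
      using fps_uminus_nth_tendsto[OF that] by simp
    from fps_mult_nth_tendsto[OF reduced_zeta_fps_summable this]
    show ?max by (simp add: max_eq reduced_zeta_fps_suminf)
  qed
qed

end

subsection \<open>Convolution with the Moebius function\<close>

lemma summable_ln_weight:
  fixes \<alpha> :: "nat \<Rightarrow> real"
  assumes "q > 1" and nonneg: "\<And>m. \<alpha> m \<ge> 0" and log_log_summable: "summable (\<lambda>m. \<alpha> m * ln (ln (q ^ m)))"
  shows "summable (\<lambda>m. \<alpha> m * (1 + ln (real m)))"
proof (rule summable_comparison_test_ev)
  show "summable (\<lambda>m. 2 * (\<alpha> m * ln (ln (q ^ m))))"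
    using log_log_summable by (rule summable_mult)
  have "ln q > 0" using \<open>q > 1\<close> by simp
  then have "\<forall>\<^sub>F m in sequentially. 1 + ln (real m) \<le> 2 * ln (real m * ln q)"
    by real_asymp
  then show "\<forall>\<^sub>F m in sequentially. norm (\<alpha> m * (1 + ln (real m))) \<le> 2 * (\<alpha> m * ln (ln (q ^ m)))"
    using eventually_ge_at_top[of 1]
  proof eventually_elim
    case (elim m)
    then have "norm (\<alpha> m * (1 + ln (real m))) = \<alpha> m * (1 + ln (real m))"
      using nonneg[of m] by (simp add: abs_mult)
    also have "\<dots> \<le> \<alpha> m * (2 * ln (real m * ln q))"
      using elim(1) nonneg by (rule mult_left_mono)
    finally show ?case using \<open>q > 1\<close> by (simp add: ln_realpow)
  qed
qed

context graded_primes
begin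

lemma sum_deg_le_tendsto_0:
  fixes t :: "'p multiset \<Rightarrow> nat \<Rightarrow> 'a :: {banach, real_normed_algebra}" and w :: "'p multiset \<Rightarrow> real"
  assumes bound: "\<And>h n. h \<in> X \<Longrightarrow> norm (t h n) \<le> w h"
    and summable: "summable (\<lambda>m. \<Sum>h\<in>{h \<in> X. deg h = m}. w h)"
    and lim: "\<And>h. h \<in> X \<Longrightarrow> t h \<longlonglongrightarrow> 0"
  shows "(\<lambda>n. \<Sum>h\<in>{h \<in> X. deg h \<le> n}. t h n) \<longlonglongrightarrow> 0"
proof -
  define b where "b m n = (if m \<le> n then \<Sum>h\<in>{h \<in> X. deg h = m}. t h n else 0)" for m n
  have "(\<lambda>n. suminf (\<lambda>m. b m n)) \<longlonglongrightarrow> suminf (\<lambda>_::nat. 0)"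
  proof (rule conjunct2[OF conjunct2[OF tannerys_theorem[OF _ _ summable]]])
    fix m
    have "(\<lambda>n. \<Sum>h\<in>{h \<in> X. deg h = m}. t h n) \<longlonglongrightarrow> (\<Sum>h\<in>{h \<in> X. deg h = m}. 0)"
      by (intro tendsto_sum) (use lim in auto)
    moreover have "\<forall>\<^sub>F n in sequentially. (\<Sum>h\<in>{h \<in> X. deg h = m}. t h n) = b m n"
      using eventually_ge_at_top[of m] by eventually_elim (simp add: b_def)
    ultimately show "(\<lambda>n. b m n) \<longlonglongrightarrow> 0"
      by (simp add: Lim_transform_eventually)
    have "norm (b m n) \<le> (\<Sum>h\<in>{h \<in> X. deg h = m}. w h)" for m n
    proof -
      have "norm (\<Sum>h\<in>{h \<in> X. deg h = m}. t h n) \<le> (\<Sum>h\<in>{h \<in> X. deg h = m}. w h)"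
        by (intro order.trans[OF norm_sum] sum_mono bound) simp
      moreover from this have "0 \<le> (\<Sum>h\<in>{h \<in> X. deg h = m}. w h)"
        by (rule order.trans[OF norm_ge_zero])
      ultimately show ?thesis by (simp add: b_def)
    qed
    then show "\<forall>\<^sub>F (m, n) in sequentially \<times>\<^sub>F sequentially. norm (b m n) \<le> (\<Sum>h\<in>{h \<in> X. deg h = m}. w h)"
      by (intro always_eventually) auto
  qed simp
  moreover have "suminf (\<lambda>m. b m n) = (\<Sum>h\<in>{h \<in> X. deg h \<le> n}. t h n)" for n
  proof -
    have "suminf (\<lambda>m. b m n) = (\<Sum>m\<le>n. b m n)"
      by (rule suminf_finite) (auto simp: b_def)
    then show ?thesis by (simp add: b_def sum_deg_le_eq_sum_deg_eq)
  qed
  ultimately show ?thesis by simp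
qed

lemma deg_mono: "h \<subseteq># g \<Longrightarrow> deg h \<le> deg g"
  by (auto simp: mset_subset_eq_exists_conv)

lemma gen_fps_conv_mu_partial_sum:
  "fps_nth (gen_fps (\<lambda>g. conv_mu a g * F g) X / (1 - fps_X)) n =
    (\<Sum>h\<in>{h. deg h \<le> n}. a h / of_real q ^ deg h *
      fps_nth (gen_fps (\<lambda>r. of_int (mu_G r) * F (h + r)) {r. h + r \<in> X} / (1 - fps_X)) (n - deg h))"
proof -
  let ?t = "\<lambda>h r. a h / of_real q ^ deg h * (of_int (mu_G r) * F (h + r) / of_real q ^ deg r)"
  have finite_divisors: "finite {r. r \<subseteq># g}" for g :: "'p multiset"
    by (rule finite_subset[OF _ finite_deg_le[of "deg g"]]) (auto intro: deg_mono)
  have "fps_nth (gen_fps (\<lambda>g. conv_mu a g * F g) X / (1 - fps_X)) n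
      = (\<Sum>g\<in>{g \<in> X. deg g \<le> n}. \<Sum>r\<in>{r. r \<subseteq># g}. ?t (g - r) r)"
    unfolding gen_fps_partial_sum conv_mu_def sum_distrib_right sum_divide_distrib
  proof (intro sum.cong refl)
    fix g r :: "'p multiset"
    assume "r \<in> {r. r \<subseteq># g}"
    then obtain h where "g = h + r" by (metis mem_Collect_eq subset_mset.diff_add)
    then show "of_int (mu_G r) * a (g - r) * F g / complex_of_real (q ^ deg g) = ?t (g - r) r"
      by (simp add: power_add)
  qed
  also have "\<dots> = (\<Sum>(g, r)\<in>(SIGMA g:{g \<in> X. deg g \<le> n}. {r. r \<subseteq># g}). ?t (g - r) r)"
    by (rule sum.Sigma) (auto simp: finite_divisors)
  also have "\<dots> = (\<Sum>(h, r)\<in>(SIGMA h:{h. deg h \<le> n}. {r \<in> {r. h + r \<in> X}. deg r \<le> n - deg h}). ?t h r)"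
    by (rule sum.reindex_bij_witness[where i = "\<lambda>(h, r). (h + r, r)" and j = "\<lambda>(g, r). (g - r, r)"])
      (auto simp: mset_subset_eq_exists_conv add.commute)
  also have "\<dots> = (\<Sum>h\<in>{h. deg h \<le> n}. \<Sum>r\<in>{r \<in> {r. h + r \<in> X}. deg r \<le> n - deg h}. ?t h r)"
    by (rule sum.Sigma[symmetric]) (use finite_deg_le in auto)
  finally show ?thesis by (simp add: gen_fps_partial_sum sum_distrib_left)
qed

lemma gen_fps_conv_mu_Dset_partial_sum:
  assumes supp: "\<And>g. g \<notin> Dset dg S \<Longrightarrow> a g = 0" and a_e: "a {#} = 1"
  shows "fps_nth (gen_fps (\<lambda>g. conv_mu a g * f (d_minus dg g)) (Dset dg S - {{#}}) / (1 - fps_X)) n =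
    fps_nth (cofactor_fps S f {#} / (1 - fps_X)) n +
    (\<Sum>h\<in>{h \<in> Dset dg S - {{#}}. deg h \<le> n}. a h / of_real q ^ deg h *
      fps_nth (cofactor_fps S f h / (1 - fps_X)) (n - deg h))"
proof -
  let ?t = "\<lambda>h. a h / of_real q ^ deg h * fps_nth (cofactor_fps S f h / (1 - fps_X)) (n - deg h)"
  have "(\<Sum>h\<in>{h. deg h \<le> n}. ?t h) = (\<Sum>h\<in>insert {#} {h \<in> Dset dg S - {{#}}. deg h \<le> n}. ?t h)"
    by (rule sum.mono_neutral_right) (use finite_deg_le supp in auto)
  also have "\<dots> = ?t {#} + (\<Sum>h\<in>{h \<in> Dset dg S - {{#}}. deg h \<le> n}. ?t h)"
    by (subst sum.insert) auto
  finally show ?thesis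
    unfolding gen_fps_conv_mu_partial_sum cofactor_fps_def[symmetric] by (simp add: a_e)
qed

end

context axiom_A_zeta_nonzero_semigroup
begin

lemma min_prime_fps_partial_sum_eq:
  "min_prime_fps Q / (1 - fps_X) = - (prime_fps Q * (moebius_fps (- {P. dg P \<le> dg Q}) / (1 - fps_X)))"
  by (simp add: min_prime_fps_eq fps_divide_unit mult.assoc)

lemma cofactor_fps_partial_sum_nth:
  assumes "Q\<^sub>0 \<in> S" and "is_min_prime dg Q\<^sub>0 h"
  shows "fps_nth (cofactor_fps S f h / (1 - fps_X)) n =
    f (dg Q\<^sub>0) * fps_nth (moebius_fps (- ({P. dg P \<le> dg Q\<^sub>0} - {Q\<^sub>0})) / (1 - fps_X)) n +
    (\<Sum>Q\<in>{Q \<in> S. dg Q < dg Q\<^sub>0}. f (dg Q) * fps_nth (min_prime_fps Q / (1 - fps_X)) n)"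
  by (simp add: cofactor_fps_eq[OF assms] fps_divide_unit distrib_right sum_distrib_right fps_sum_nth mult.assoc)

lemma cofactor_fps_partial_sums_tendsto_0:
  assumes "h \<in> Dset dg S - {{#}}"
  shows "fps_nth (cofactor_fps S f h / (1 - fps_X)) \<longlonglongrightarrow> 0"
proof -
  obtain Q\<^sub>0 where Q\<^sub>0: "Q\<^sub>0 \<in> S" "is_min_prime dg Q\<^sub>0 h"
    using assms by (auto simp: Dset_minus_empty_eq)
  have "fps_nth (min_prime_fps Q / (1 - fps_X)) \<longlonglongrightarrow> 0" for Q
    unfolding min_prime_fps_partial_sum_eq
    using fps_uminus_nth_tendsto[OF prime_fps_mult_tendsto_0[OF moebius_fps_Compl_partial_sums_tendsto_0]]
    by (simp add: finite_dg_le)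
  then have "(\<lambda>n. fps_nth (cofactor_fps S f h / (1 - fps_X)) n) \<longlonglongrightarrow>
      f (dg Q\<^sub>0) * 0 + (\<Sum>Q\<in>{Q \<in> S. dg Q < dg Q\<^sub>0}. f (dg Q) * 0)"
    unfolding cofactor_fps_partial_sum_nth[OF Q\<^sub>0]
    by (intro tendsto_intros moebius_fps_Compl_partial_sums_tendsto_0) (simp_all add: finite_dg_le)
  then show ?thesis by simp
qed

lemma norm_cofactor_fps_partial_sum_le:
  assumes Q\<^sub>0: "Q\<^sub>0 \<in> S" "is_min_prime dg Q\<^sub>0 h" and f_le: "\<And>n. norm (f n) \<le> B"
    and moebius_le: "\<And>A n. norm (fps_nth (moebius_fps A / (1 - fps_X)) n) \<le> M"
  shows "norm (fps_nth (cofactor_fps S f h / (1 - fps_X)) n) \<le>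
    B * M * (1 + (\<Sum>Q\<in>{Q \<in> S. dg Q < dg Q\<^sub>0}. 1 / q ^ dg Q))"
proof -
  have "B \<ge> 0" using order.trans[OF norm_ge_zero f_le] .
  have "norm (fps_nth (min_prime_fps Q / (1 - fps_X)) n) \<le> M / q ^ dg Q" for Q
    unfolding min_prime_fps_partial_sum_eq using norm_prime_fps_mult_nth_le[OF moebius_le] by simp
  then have "norm (fps_nth (cofactor_fps S f h / (1 - fps_X)) n) \<le>
      B * M + (\<Sum>Q\<in>{Q \<in> S. dg Q < dg Q\<^sub>0}. B * (M / q ^ dg Q))"
    unfolding cofactor_fps_partial_sum_nth[OF Q\<^sub>0]
    by (intro norm_triangle_mono order.trans[OF norm_sum] sum_mono)
      (auto simp only: norm_mult intro!: mult_mono f_le moebius_le \<open>B \<ge> 0\<close> norm_ge_zero)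
  also have "\<dots> = B * M * (1 + (\<Sum>Q\<in>{Q \<in> S. dg Q < dg Q\<^sub>0}. 1 / q ^ dg Q))"
    by (simp add: distrib_left sum_distrib_left)
  finally show ?thesis .
qed

lemma cofactor_fps_partial_sums_le_ln:
  assumes f_bdd: "bounded (range f)"
  obtains K where "\<And>h n. h \<in> Dset dg S - {{#}} \<Longrightarrow>
    norm (fps_nth (cofactor_fps S f h / (1 - fps_X)) n) \<le> K * (1 + ln (real (deg h)))"
proof -
  obtain B where f_le: "\<And>n. norm (f n) \<le> B"
    using f_bdd by (auto simp: bounded_iff)
  obtain M where moebius_le: "\<And>A n. norm (fps_nth (moebius_fps A / (1 - fps_X)) n) \<le> M"
    using moebius_fps_partial_sums_bounded by blast
  obtain K where "K \<ge> 0"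
    and primes_le: "\<And>d. d \<ge> 1 \<Longrightarrow> (\<Sum>P\<in>{P. dg P \<le> d}. 1 / q ^ dg P) \<le> K * (1 + ln (real d))"
    using sum_inverse_primes_le_ln by blast
  have "B * M \<ge> 0"
    using order.trans[OF norm_ge_zero f_le] order.trans[OF norm_ge_zero moebius_le] by simp
  show thesis
  proof
    fix h n assume "h \<in> Dset dg S - {{#}}"
    then obtain Q\<^sub>0 where Q\<^sub>0: "Q\<^sub>0 \<in> S" "is_min_prime dg Q\<^sub>0 h"
      by (auto simp: Dset_minus_empty_eq)
    then have deg: "1 \<le> dg Q\<^sub>0" "dg Q\<^sub>0 \<le> deg h"
      using dg_pos[of Q\<^sub>0] dg_le_deg[of Q\<^sub>0 h] by (auto simp: is_min_prime_def)
    have "(\<Sum>Q\<in>{Q \<in> S. dg Q < dg Q\<^sub>0}. 1 / q ^ dg Q) \<le> (\<Sum>P\<in>{P. dg P \<le> deg h}. 1 / q ^ dg P)"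
      by (rule sum_mono2) (use finite_dg_le q_pos deg in auto)
    also have "\<dots> \<le> K * (1 + ln (real (deg h)))"
      using deg by (intro primes_le) simp
    finally have "(\<Sum>Q\<in>{Q \<in> S. dg Q < dg Q\<^sub>0}. 1 / q ^ dg Q) \<le> K * (1 + ln (real (deg h)))" .
    moreover have "0 \<le> ln (real (deg h))" using deg by simp
    ultimately have "1 + (\<Sum>Q\<in>{Q \<in> S. dg Q < dg Q\<^sub>0}. 1 / q ^ dg Q) \<le> (1 + K) * (1 + ln (real (deg h)))"
      by (simp add: distrib_right)
    then have "B * M * (1 + (\<Sum>Q\<in>{Q \<in> S. dg Q < dg Q\<^sub>0}. 1 / q ^ dg Q))
        \<le> B * M * ((1 + K) * (1 + ln (real (deg h))))"
      using \<open>B * M \<ge> 0\<close> by (rule mult_left_mono)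
    then show "norm (fps_nth (cofactor_fps S f h / (1 - fps_X)) n)
        \<le> B * M * (1 + K) * (1 + ln (real (deg h)))"
      using norm_cofactor_fps_partial_sum_le[where f = f and n = n, OF Q\<^sub>0 f_le moebius_le] by (simp only: mult.assoc)
  qed
qed

lemma conv_mu_partial_sums_diff_tendsto_0:
  assumes supp: "\<And>g. g \<notin> Dset dg S \<Longrightarrow> a g = 0" and a_e: "a {#} = 1" and f_bdd: "bounded (range f)"
    and conv: "convergent (\<lambda>n. \<Sum>g\<in>{g \<in> Dset dg S - {{#}}. deg g \<le> n}.
      norm (a g) / q ^ deg g * ln (ln (q ^ deg g)))"
  shows "(\<lambda>n. fps_nth (gen_fps (\<lambda>g. conv_mu a g * f (d_minus dg g)) (Dset dg S - {{#}}) / (1 - fps_X)) n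
    - fps_nth (cofactor_fps S f {#} / (1 - fps_X)) n) \<longlonglongrightarrow> 0"
proof -
  let ?D = "Dset dg S - {{#}}"
  define \<alpha> where "\<alpha> m = (\<Sum>h\<in>{h \<in> ?D. deg h = m}. norm (a h) / q ^ deg h)" for m
  define t where "t h n = a h / of_real q ^ deg h * fps_nth (cofactor_fps S f h / (1 - fps_X)) (n - deg h)" for h n
  obtain K where cofactor_le: "\<And>h n. h \<in> ?D \<Longrightarrow>
      norm (fps_nth (cofactor_fps S f h / (1 - fps_X)) n) \<le> K * (1 + ln (real (deg h)))"
    using cofactor_fps_partial_sums_le_ln[OF f_bdd] by blast
  have \<alpha>_mult: "(\<Sum>h\<in>{h \<in> ?D. deg h = m}. norm (a h) / q ^ deg h * F (deg h)) = \<alpha> m * F m" for F m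
    unfolding \<alpha>_def sum_distrib_right by (intro sum.cong refl) auto
  have "summable (\<lambda>m. \<alpha> m * ln (ln (q ^ m)))"
    using conv unfolding sum_deg_le_eq_sum_deg_eq \<alpha>_mult[of "\<lambda>m. ln (ln (q ^ m))"]
    by (simp add: summable_iff_convergent')
  then have "summable (\<lambda>m. \<alpha> m * (1 + ln (real m)))"
    by (rule summable_ln_weight[OF q_gt_1, rotated]) (use q_pos in \<open>simp add: \<alpha>_def sum_nonneg\<close>)
  then have "summable (\<lambda>m. \<alpha> m * (K * (1 + ln (real m))))"
    unfolding mult.left_commute[of _ K] by (rule summable_mult)
  then have summable: "summable (\<lambda>m. \<Sum>h\<in>{h \<in> ?D. deg h = m}. norm (a h) / q ^ deg h * (K * (1 + ln (real (deg h)))))"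
    unfolding \<alpha>_mult[of "\<lambda>m. K * (1 + ln (real m))"] .
  have "(\<lambda>n. \<Sum>h\<in>{h \<in> ?D. deg h \<le> n}. t h n) \<longlonglongrightarrow> 0"
  proof (rule sum_deg_le_tendsto_0[OF _ summable])
    fix h assume h: "h \<in> ?D"
    show "norm (t h n) \<le> norm (a h) / q ^ deg h * (K * (1 + ln (real (deg h))))" for n
      using mult_left_mono[OF cofactor_le[OF h], of "norm (a h) / q ^ deg h"] q_pos
      by (simp add: t_def norm_mult norm_divide norm_power)
    have "(\<lambda>n. fps_nth (cofactor_fps S f h / (1 - fps_X)) (n - deg h)) \<longlonglongrightarrow> 0"
      by (rule LIMSEQ_offset[where k = "deg h"]) (simp add: cofactor_fps_partial_sums_tendsto_0[OF h])
    then show "t h \<longlonglongrightarrow> 0"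
      unfolding t_def by (rule tendsto_mult_right_zero)
  qed
  then show ?thesis
    by (simp add: gen_fps_conv_mu_Dset_partial_sum[where S = S and a = a, OF supp a_e] t_def)
qed

end

theorem theorem2p3:
  fixes dg :: "'p \<Rightarrow> nat" and c q \<eta> \<delta> :: real and S :: "'p set"
    and f :: "nat \<Rightarrow> complex" and a :: "'p multiset \<Rightarrow> complex"
  assumes sg: "arith_semigroup dg"
    and A: "axiom_A_sharp dg c q \<eta>"
    and Z: "zeta_nonzero_at_minus dg q \<eta>"
    and dens: "natural_density dg S \<delta>"
    and f_bdd: "bounded (range f)"
    and f0: "f 0 = 0"
    and a_supp: "\<forall>g. g \<notin> Dset dg S \<longrightarrow> a g = 0"
    and a_e: "a {#} = 1"
    and a_conv: "convergent (\<lambda>n. \<Sum>g\<in>{g. 1 \<le> degG dg g \<and> degG dg g \<le> n \<and> g \<in> Dset dg S}.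
                   norm (a g) / q ^ degG dg g * ln (ln (q ^ degG dg g)))"
  shows "(((\<lambda>n. (\<Sum>g\<in>{g. degG dg g = n}. of_nat (Q_S dg S g) * f (d_plus dg g))
              - complex_of_real (c * \<delta> * q ^ n))
            \<in> o(\<lambda>n. complex_of_real (q ^ n)))
         \<longleftrightarrow>
         ((\<lambda>n. \<Sum>g\<in>{g. 1 \<le> degG dg g \<and> degG dg g \<le> n \<and> g \<in> Dset dg S}.
              of_int (mu_G g) * f (d_minus dg g) / complex_of_real (q ^ degG dg g))
            \<longlonglongrightarrow> - complex_of_real \<delta>)) \<and>
         (((\<lambda>n. \<Sum>g\<in>{g. 1 \<le> degG dg g \<and> degG dg g \<le> n \<and> g \<in> Dset dg S}.
              of_int (mu_G g) * f (d_minus dg g) / complex_of_real (q ^ degG dg g))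
            \<longlonglongrightarrow> - complex_of_real \<delta>)
         \<longleftrightarrow>
         ((\<lambda>n. \<Sum>g\<in>{g. 1 \<le> degG dg g \<and> degG dg g \<le> n \<and> g \<in> Dset dg S}.
              conv_mu a g * f (d_minus dg g) / complex_of_real (q ^ degG dg g))
            \<longlonglongrightarrow> - complex_of_real \<delta>))"
proof -
  interpret axiom_A_zeta_nonzero_semigroup dg c q \<eta>
    using sg A Z by unfold_locales
  have "(\<lambda>n. (\<Sum>g\<in>{g. deg g = n}. of_nat (Q_S dg S g) * f (d_plus dg g)) - complex_of_real (c * \<delta> * q ^ n))
      \<in> o(\<lambda>n. complex_of_real (q ^ n)) \<longleftrightarrow> fps_nth (max_prime_fps S f) \<longlonglongrightarrow> of_real (c * \<delta>)"
    by (rule max_prime_sum_asymp_iff)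
  also have "\<dots> \<longleftrightarrow> fps_nth (cofactor_fps S f {#} / (1 - fps_X)) \<longlonglongrightarrow> - of_real \<delta>"
    by (rule max_prime_fps_tendsto_iff)
  finally have i_iff_ii: "(\<lambda>n. (\<Sum>g\<in>{g. deg g = n}. of_nat (Q_S dg S g) * f (d_plus dg g))
        - complex_of_real (c * \<delta> * q ^ n)) \<in> o(\<lambda>n. complex_of_real (q ^ n)) \<longleftrightarrow>
      fps_nth (cofactor_fps S f {#} / (1 - fps_X)) \<longlonglongrightarrow> - of_real \<delta>" .
  have ii_iff_iii: "fps_nth (cofactor_fps S f {#} / (1 - fps_X)) \<longlonglongrightarrow> - of_real \<delta> \<longleftrightarrow>
      fps_nth (gen_fps (\<lambda>g. conv_mu a g * f (d_minus dg g)) (Dset dg S - {{#}}) / (1 - fps_X)) \<longlonglongrightarrow> - of_real \<delta>"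
    by (intro Lim_transform_eq[symmetric] conv_mu_partial_sums_diff_tendsto_0 a_e f_bdd
        a_conv[unfolded Dset_deg_between_eq]) (use a_supp in blast)
  show ?thesis
    unfolding Dset_deg_between_eq gen_fps_partial_sum[symmetric] cofactor_fps_empty[symmetric]
    using i_iff_ii ii_iff_iii by (rule conjI)
qed

end
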